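(* Let $(\phi_h^{m+1},\mu_h^{m+\frac12},\mathbf{u}_h^{m+1},p_h^{m+1})\in S_h\times S_h\times\mathbf{X}_h\times\mathring{S}_h$, $1\le m\le M-1$, be the unique solution of the fully discrete scheme (S1)--(S4) given in the context. Then for any $h,\tau>0$ and all $1\le \ell\le M-1$, $$F\left(\phi_h^{\ell+1},\phi_h^{\ell},\mathbf{u}_h^{\ell+1}\right)+\tau\sum_{m=1}^{\ell}\left(\varepsilon\left\|\nabla\mu_h^{m+\frac12}\right\|^2+\frac{\eta}{\gamma}\left\|\nabla\bar{\mathbf{u}}_h^{m+\frac12}\right\|^2\right)+\sum_{m=1}^{\ell}\left[\frac{1}{4\varepsilon}\left\|\phi_h^{m+1}-2\phi_h^m+\phi_h^{m-1}\right\|^2+\frac{\varepsilon}{8}\left\|\nabla\phi_h^{m+1}-2\nabla\phi_h^m+\nabla\phi_h^{m-1}\right\|^2\right]=F\left(\phi_h^1,\phi_h^0,\mathbf{u}_h^1\right).$$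
   Context: Notation. $\Omega\subset\mathbb{R}^d$, $d=2,3$, is an open (bounded) polygonal or polyhedral domain; $\varepsilon,\eta,\gamma>0$ are constants; $T>0$. $(\cdot,\cdot)$ and $\|\cdot\|$ are the $L^2(\Omega)$ inner product and norm; $L^2_0(\Omega)$ is the subspace of mean-zero functions in $L^2(\Omega)$; $\mathbf{H}^1_0(\Omega)=[H^1_0(\Omega)]^d$. Define $a(u,v)=(\nabla u,\nabla v)$, $b(\psi,\mathbf{v},\nu)=(\nabla\psi\cdot\mathbf{v},\nu)$, $c(\mathbf{v},q)=(\nabla\cdot\mathbf{v},q)$, $B(\mathbf{u},\mathbf{v},\mathbf{w})=\frac12[(\mathbf{u}\cdot\nabla\mathbf{v},\mathbf{w})-(\mathbf{u}\cdot\nabla\mathbf{w},\mathbf{v})]$. PDE. $(\phi,\mu,\mathbf{u},p)$ is a weak solution on $(0,T)$ of the Cahn-Hilliard-Navier-Stokes system: for a.e. $t$, $\langle\partial_t\phi,\nu\rangle+\varepsilon a(\mu,\nu)+b(\phi,\mathbf{u},\nu)=0$ for all $\nu\in H^1(\Omega)$; $(\mu,\psi)-\varepsilon a(\phi,\psi)-\varepsilon^{-1}(\phi^3-\phi,\psi)=0$ for all $\psi\in H^1(\Omega)$; $\langle\partial_t\mathbf{u},\mathbf{v}\rangle+\eta a(\mathbf{u},\mathbf{v})+B(\mathbf{u},\mathbf{u},\mathbf{v})-c(\mathbf{v},p)-\gamma b(\phi,\mathbf{v},\mu)=0$ for all $\mathbf{v}\in\mathbf{H}_0^1(\Omega)$;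 $c(\mathbf{u},q)=0$ for all $q\in L_0^2(\Omega)$; with $\phi(0)=\phi_0$, $\mathbf{u}(0)=\mathbf{u}_0$, $\mathbf u(t)\in\mathbf H^1_0(\Omega)$, $p(t)\in L^2_0(\Omega)$. It is used here only to define the initial data of the scheme. Discretization. $M$ is a positive integer, $\tau=T/M$, $t_m=m\tau$. $\mathcal{T}_h$ is a conforming, shape-regular, quasi-uniform family of triangulations of $\Omega$. $\mathcal{M}_r^h=\{v\in C^0(\Omega): v|_K\in\mathcal{P}_r(K)\ \forall K\in\mathcal{T}_h\}$, $\mathcal{M}_{r,0}^h=\mathcal{M}_r^h\cap H_0^1(\Omega)$. For a fixed positive integer $q$: $S_h=\mathcal{M}_q^h$, $\mathring{S}_h=S_h\cap L_0^2(\Omega)$, $\mathbf{X}_h=[\mathcal{M}_{q+1,0}^h]^d$, $\mathbf{V}_h=\{\mathbf{v}\in\mathbf{X}_h:(\nabla\cdot\mathbf{v},w)=0\ \forall w\in\mathring{S}_h\}$. For a discrete sequence $\psi^m$ (scalar or vector): $\delta_\tau\psi^{m+\frac12}=(\psi^{m+1}-\psi^m)/\tau$, $\bar\psi^{m+\frac12}=\frac12\psi^{m+1}+\frac12\psi^m$, $\tilde\psi^{m+\frac12}=\frac32\psi^m-\frac12\psi^{m-1}$, $\check\psi^{m+\frac12}=\frac34\psi^{m+1}+\frac14\psi^{m-1}$; and $\chi(\phi_h^{m+1},\phi_h^m)=\frac12((\phi_h^{m+1})^2+(\phi_h^m)^2)\bar\phi_h^{m+\frac12}$. Scheme: for $1\le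 m\le M-1$, given $\phi_h^m,\phi_h^{m-1}\in S_h$, $\mathbf{u}_h^m,\mathbf{u}_h^{m-1}\in\mathbf{X}_h$, $p_h^m\in\mathring{S}_h$, find $\phi_h^{m+1},\mu_h^{m+\frac12}\in S_h$, $\mathbf{u}_h^{m+1}\in\mathbf{X}_h$, $p_h^{m+1}\in\mathring{S}_h$ such that (S1) $(\delta_\tau\phi_h^{m+\frac12},\nu)+\varepsilon a(\mu_h^{m+\frac12},\nu)+b(\tilde\phi_h^{m+\frac12},\bar{\mathbf{u}}_h^{m+\frac12},\nu)=0$ for all $\nu\in S_h$; (S2) $\frac1\varepsilon(\chi(\phi_h^{m+1},\phi_h^m),\psi)-\frac1\varepsilon(\tilde\phi_h^{m+\frac12},\psi)+\varepsilon a(\check\phi_h^{m+\frac12},\psi)-(\mu_h^{m+\frac12},\psi)=0$ for all $\psi\in S_h$; (S3) $(\delta_\tau\mathbf{u}_h^{m+\frac12},\mathbf{v})+\eta a(\bar{\mathbf{u}}_h^{m+\frac12},\mathbf{v})+B(\tilde{\mathbf{u}}_h^{m+\frac12},\bar{\mathbf{u}}_h^{m+\frac12},\mathbf{v})-c(\mathbf{v},\bar p_h^{m+\frac12})-\gamma b(\tilde\phi_h^{m+\frac12},\mathbf{v},\mu_h^{m+\frac12})=0$ for all $\mathbf{v}\in\mathbf{X}_h$; (S4) $c(\bar{\mathbf{u}}_h^{m+\frac12},q)=0$ for all $q\in\mathring{S}_h$. Initial data: $\phi_h^0=R_h\phi_0$, $\phi_h^1=R_h\phi(\tau)$, $(\mathbf{u}_h^0,p_h^0)=(\mathbf{P}_h\mathbf{u}_0,P_hp(0))$,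 $(\mathbf{u}_h^1,p_h^1)=(\mathbf{P}_h\mathbf{u}(\tau),P_hp(\tau))$, where $R_h:H^1(\Omega)\to S_h$ is the Ritz projection, $a(R_h\phi-\phi,\xi)=0$ for all $\xi\in S_h$ and $(R_h\phi-\phi,1)=0$, and $(\mathbf{P}_h\mathbf{u},P_hp)\in\mathbf{V}_h\times\mathring{S}_h$ is the Stokes projection, $\eta a(\mathbf{P}_h\mathbf{u}-\mathbf{u},\mathbf{v})-c(\mathbf{v},P_hp-p)=0$ for all $\mathbf{v}\in\mathbf{X}_h$, $c(\mathbf{P}_h\mathbf{u}-\mathbf{u},q)=0$ for all $q\in\mathring{S}_h$. The scheme is uniquely solvable for all $h,\tau>0$. Energies. $E(\phi,\mathbf{u})=\int_\Omega\{\frac{1}{4\varepsilon}(\phi^2-1)^2+\frac{\varepsilon}{2}|\nabla\phi|^2+\frac{1}{2\gamma}|\mathbf{u}|^2\}\,d\mathbf{x}$ and $F(\phi,\psi,\mathbf{u})=E(\phi,\mathbf{u})+\frac{1}{4\varepsilon}\|\phi-\psi\|^2+\frac{\varepsilon}{8}\|\nabla\phi-\nabla\psi\|^2$. *)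

theory Defs
  imports "HOL-Analysis.Analysis"
begin

section \<open>Lebesgue and Sobolev spaces\<close>

text \<open>
  Elements of function spaces over \<open>\<Omega>\<close> are represented by total functions on \<open>\<real>\<^sup>d\<close>; only
  their values on \<open>\<Omega>\<close> (up to null sets) matter. The \<open>L\<^sup>2\<close> notions are polymorphic in the
  codomain, so that they cover scalar, vector and matrix fields; on matrices the inner product of
  the type \<open>real ^ 'd ^ 'd\<close> is the Frobenius product.
\<close>

definition L2 :: "'a::euclidean_space set \<Rightarrow> ('a \<Rightarrow> 'b::euclidean_space) set" where
  "L2 \<Omega> = {f. set_borel_measurable lebesgue \<Omega> f \<and>
              set_integrable lebesgue \<Omega> (\<lambda>x. (norm (f x))\<^sup>2)}"

definition ip :: "'a::euclidean_space set \<Rightarrow> ('a \<Rightarrow> 'b::euclidean_space) \<Rightarrow> ('a \<Rightarrow> 'b) \<Rightarrow> real" where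
  "ip \<Omega> f g = (LINT x:\<Omega>|lebesgue. f x \<bullet> g x)"

definition nrm :: "'a::euclidean_space set \<Rightarrow> ('a \<Rightarrow> 'b::euclidean_space) \<Rightarrow> real" where
  "nrm \<Omega> f = sqrt (ip \<Omega> f f)"

definition L20 :: "'a::euclidean_space set \<Rightarrow> ('a \<Rightarrow> real) set" where
  "L20 \<Omega> = {f \<in> L2 \<Omega>. (LINT x:\<Omega>|lebesgue. f x) = 0}"

primrec C_k :: "nat \<Rightarrow> ('a::euclidean_space \<Rightarrow> real) \<Rightarrow> bool" where
  "C_k 0 f = continuous_on UNIV f"
| "C_k (Suc k) f = (f differentiable_on UNIV \<and>
     (\<forall>b\<in>Basis. C_k k (\<lambda>x. frechet_derivative f (at x) b)))"

definition test_functions :: "'a::euclidean_space set \<Rightarrow> ('a \<Rightarrow> real) set" where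
  "test_functions \<Omega> = {\<theta>. (\<forall>k. C_k k \<theta>) \<and> compact (closure {x. \<theta> x \<noteq> 0}) \<and>
                           closure {x. \<theta> x \<noteq> 0} \<subseteq> \<Omega>}"

definition has_weak_grad ::
  "(real ^ 'd) set \<Rightarrow> (real ^ 'd \<Rightarrow> real) \<Rightarrow> (real ^ 'd \<Rightarrow> real ^ 'd) \<Rightarrow> bool" where
  "has_weak_grad \<Omega> u g \<longleftrightarrow> (\<forall>\<theta>\<in>test_functions \<Omega>. \<forall>i.
     (LINT x:\<Omega>|lebesgue. u x * frechet_derivative \<theta> (at x) (axis i 1)) =
     - (LINT x:\<Omega>|lebesgue. g x $ i * \<theta> x))"

definition H1 :: "(real ^ 'd) set \<Rightarrow> (real ^ 'd \<Rightarrow> real) set" where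
  "H1 \<Omega> = {u \<in> L2 \<Omega>. \<exists>g\<in>L2 \<Omega>. has_weak_grad \<Omega> u g}"

text \<open>
  A representative of the weak gradient (unique almost everywhere on \<open>\<Omega>\<close>); meaningful only for
  \<open>u \<in> H1 \<Omega>\<close>.
\<close>

definition grad :: "(real ^ 'd) set \<Rightarrow> (real ^ 'd \<Rightarrow> real) \<Rightarrow> real ^ 'd \<Rightarrow> real ^ 'd" where
  "grad \<Omega> u = (SOME g. g \<in> L2 \<Omega> \<and> has_weak_grad \<Omega> u g)"

text \<open>Row \<open>i\<close> of the matrix \<open>gradv \<Omega> u x\<close> is the gradient of the \<open>i\<close>-th component of \<open>u\<close>.\<close>

definition gradv :: "(real ^ 'd) set \<Rightarrow> (real ^ 'd \<Rightarrow> real ^ 'd) \<Rightarrow> real ^ 'd \<Rightarrow> real ^ 'd ^ 'd" where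
  "gradv \<Omega> u x = (\<chi> i. grad \<Omega> (\<lambda>y. u y $ i) x)"

definition divg :: "(real ^ 'd) set \<Rightarrow> (real ^ 'd \<Rightarrow> real ^ 'd) \<Rightarrow> real ^ 'd \<Rightarrow> real" where
  "divg \<Omega> u x = (\<Sum>i\<in>UNIV. gradv \<Omega> u x $ i $ i)"

definition H1_norm :: "(real ^ 'd) set \<Rightarrow> (real ^ 'd \<Rightarrow> real) \<Rightarrow> real" where
  "H1_norm \<Omega> u = sqrt ((nrm \<Omega> u)\<^sup>2 + (nrm \<Omega> (grad \<Omega> u))\<^sup>2)"

definition H1v_norm :: "(real ^ 'd) set \<Rightarrow> (real ^ 'd \<Rightarrow> real ^ 'd) \<Rightarrow> real" where
  "H1v_norm \<Omega> u = sqrt ((nrm \<Omega> u)\<^sup>2 + (nrm \<Omega> (gradv \<Omega> u))\<^sup>2)"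

definition H10 :: "(real ^ 'd) set \<Rightarrow> (real ^ 'd \<Rightarrow> real) set" where
  "H10 \<Omega> = {u \<in> H1 \<Omega>. \<forall>e>0. \<exists>\<theta>\<in>test_functions \<Omega>. H1_norm \<Omega> (\<lambda>x. u x - \<theta> x) < e}"

definition H10v :: "(real ^ 'd) set \<Rightarrow> (real ^ 'd \<Rightarrow> real ^ 'd) set" where
  "H10v \<Omega> = {u. \<forall>i. (\<lambda>x. u x $ i) \<in> H10 \<Omega>}"


section \<open>Forms\<close>

definition a_form :: "(real ^ 'd) set \<Rightarrow> (real ^ 'd \<Rightarrow> real) \<Rightarrow> (real ^ 'd \<Rightarrow> real) \<Rightarrow> real" where
  "a_form \<Omega> u v = ip \<Omega> (grad \<Omega> u) (grad \<Omega> v)"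

definition av_form ::
  "(real ^ 'd) set \<Rightarrow> (real ^ 'd \<Rightarrow> real ^ 'd) \<Rightarrow> (real ^ 'd \<Rightarrow> real ^ 'd) \<Rightarrow> real" where
  "av_form \<Omega> u v = ip \<Omega> (gradv \<Omega> u) (gradv \<Omega> v)"

definition b_form ::
  "(real ^ 'd) set \<Rightarrow> (real ^ 'd \<Rightarrow> real) \<Rightarrow> (real ^ 'd \<Rightarrow> real ^ 'd) \<Rightarrow> (real ^ 'd \<Rightarrow> real) \<Rightarrow> real" where
  "b_form \<Omega> \<psi> v \<nu> = ip \<Omega> (\<lambda>x. grad \<Omega> \<psi> x \<bullet> v x) \<nu>"

definition c_form ::
  "(real ^ 'd) set \<Rightarrow> (real ^ 'd \<Rightarrow> real ^ 'd) \<Rightarrow> (real ^ 'd \<Rightarrow> real) \<Rightarrow> real" where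
  "c_form \<Omega> v q = ip \<Omega> (divg \<Omega> v) q"

definition B_form :: "(real ^ 'd) set \<Rightarrow> (real ^ 'd \<Rightarrow> real ^ 'd) \<Rightarrow> (real ^ 'd \<Rightarrow> real ^ 'd) \<Rightarrow>
    (real ^ 'd \<Rightarrow> real ^ 'd) \<Rightarrow> real" where
  "B_form \<Omega> u v w = 1 / 2 * (ip \<Omega> (\<lambda>x. gradv \<Omega> v x *v u x) w - ip \<Omega> (\<lambda>x. gradv \<Omega> w x *v u x) v)"


section \<open>Weak solutions of the Cahn--Hilliard--Navier--Stokes system\<close>

text \<open>
  \<open>weak_time_deriv \<Omega> T V N \<phi> D\<close>: \<open>\<phi> : [0,T] \<rightarrow> L\<^sup>2(\<Omega>)\<close> is continuous in time when tested with \<open>V\<close>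
  (which gives a meaning to the initial value), and \<open>D\<close> is its distributional time derivative,
  a function in \<open>L\<^sup>1(0,T;V')\<close> where \<open>V'\<close> is the dual of \<open>V\<close> normed by \<open>N\<close>.
\<close>

definition weak_time_deriv :: "'a::euclidean_space set \<Rightarrow> real \<Rightarrow> ('a \<Rightarrow> 'b::euclidean_space) set \<Rightarrow>
    (('a \<Rightarrow> 'b) \<Rightarrow> real) \<Rightarrow> (real \<Rightarrow> 'a \<Rightarrow> 'b) \<Rightarrow> (real \<Rightarrow> ('a \<Rightarrow> 'b) \<Rightarrow> real) \<Rightarrow> bool" where
  "weak_time_deriv \<Omega> T V N \<phi> D \<longleftrightarrow>
     (\<forall>t\<in>{0<..<T}. \<forall>v\<in>V. \<forall>w\<in>V. \<forall>r s.
        D t (\<lambda>x. r *\<^sub>R v x + s *\<^sub>R w x) = r * D t v + s * D t w) \<and>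
     (\<exists>g. set_integrable lebesgue {0<..<T} g \<and> (\<forall>t\<in>{0<..<T}. \<forall>v\<in>V. \<bar>D t v\<bar> \<le> g t * N v)) \<and>
     (\<forall>v\<in>V. continuous_on {0..T} (\<lambda>t. ip \<Omega> (\<phi> t) v) \<and>
             set_integrable lebesgue {0<..<T} (\<lambda>t. D t v) \<and>
             (\<forall>\<theta>\<in>test_functions {0<..<T}.
                (LINT t:{0<..<T}|lebesgue. ip \<Omega> (\<phi> t) v * deriv \<theta> t) =
                - (LINT t:{0<..<T}|lebesgue. D t v * \<theta> t)))"

definition weak_solution :: "(real ^ 'd) set \<Rightarrow> real \<Rightarrow> real \<Rightarrow> real \<Rightarrow> real \<Rightarrow>
    (real ^ 'd \<Rightarrow> real) \<Rightarrow> (real ^ 'd \<Rightarrow> real ^ 'd) \<Rightarrow>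
    (real \<Rightarrow> real ^ 'd \<Rightarrow> real) \<Rightarrow> (real \<Rightarrow> real ^ 'd \<Rightarrow> real) \<Rightarrow>
    (real \<Rightarrow> real ^ 'd \<Rightarrow> real ^ 'd) \<Rightarrow> (real \<Rightarrow> real ^ 'd \<Rightarrow> real) \<Rightarrow> bool" where
  "weak_solution \<Omega> T \<epsilon> \<eta> \<gamma> \<phi>0 u0 \<phi> \<mu> u p \<longleftrightarrow>
     (\<forall>t\<in>{0..T}. \<phi> t \<in> H1 \<Omega> \<and> u t \<in> H10v \<Omega> \<and> p t \<in> L20 \<Omega>) \<and>
     (AE t in lebesgue. t \<in> {0<..<T} \<longrightarrow> \<mu> t \<in> H1 \<Omega>) \<and>
     (AE x in lebesgue. x \<in> \<Omega> \<longrightarrow> \<phi> 0 x = \<phi>0 x) \<and>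
     (AE x in lebesgue. x \<in> \<Omega> \<longrightarrow> u 0 x = u0 x) \<and>
     (\<exists>D\<phi> Du.
        weak_time_deriv \<Omega> T (H1 \<Omega>) (H1_norm \<Omega>) \<phi> D\<phi> \<and>
        weak_time_deriv \<Omega> T (H10v \<Omega>) (H1v_norm \<Omega>) u Du \<and>
        (AE t in lebesgue. t \<in> {0<..<T} \<longrightarrow>
          (\<forall>\<nu>\<in>H1 \<Omega>. D\<phi> t \<nu> + \<epsilon> * a_form \<Omega> (\<mu> t) \<nu> + b_form \<Omega> (\<phi> t) (u t) \<nu> = 0) \<and>
          (\<forall>\<psi>\<in>H1 \<Omega>. ip \<Omega> (\<mu> t) \<psi> - \<epsilon> * a_form \<Omega> (\<phi> t) \<psi>
                     - 1 / \<epsilon> * ip \<Omega> (\<lambda>x. \<phi> t x ^ 3 - \<phi> t x) \<psi> = 0) \<and>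
          (\<forall>v\<in>H10v \<Omega>. Du t v + \<eta> * av_form \<Omega> (u t) v + B_form \<Omega> (u t) (u t) v
                     - c_form \<Omega> v (p t) - \<gamma> * b_form \<Omega> (\<phi> t) v (\<mu> t) = 0) \<and>
          (\<forall>q\<in>L20 \<Omega>. c_form \<Omega> (u t) q = 0)))"


section \<open>Polyhedral domains and triangulations\<close>

definition polyhedral_domain :: "'a::euclidean_space set \<Rightarrow> bool" where
  "polyhedral_domain \<Omega> \<longleftrightarrow> \<Omega> \<noteq> {} \<and> connected \<Omega> \<and>
     (\<exists>\<F>. finite \<F> \<and> (\<forall>P\<in>\<F>. polytope P) \<and> \<Omega> = interior (\<Union>\<F>))"

text \<open>
  The library notion \<^const>\<open>triangulation\<close> includes conformity: any two cells meet in a common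
  face. Cells are closed simplices.
\<close>

definition mesh_on :: "'a::euclidean_space set \<Rightarrow> 'a set set \<Rightarrow> bool" where
  "mesh_on \<Omega> Tr \<longleftrightarrow> triangulation Tr \<and> (\<forall>K\<in>Tr. int DIM('a) simplex K) \<and> closure \<Omega> = \<Union>Tr"

definition inradius :: "'a::euclidean_space set \<Rightarrow> real" where
  "inradius K = Sup {r. 0 \<le> r \<and> (\<exists>x. cball x r \<subseteq> K)}"

text \<open>A shape-regular, quasi-uniform family of meshes, indexed by a set \<open>H\<close> of mesh sizes.\<close>

definition mesh_family :: "'a::euclidean_space set \<Rightarrow> real set \<Rightarrow> (real \<Rightarrow> 'a set set) \<Rightarrow> bool" where
  "mesh_family \<Omega> H Tr \<longleftrightarrow>
     (\<forall>h\<in>H. 0 < h \<and> mesh_on \<Omega> (Tr h) \<and> h = Max (diameter ` Tr h)) \<and>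
     (\<exists>\<sigma>. \<forall>h\<in>H. \<forall>K\<in>Tr h. diameter K \<le> \<sigma> * inradius K) \<and>
     (\<exists>\<kappa>>0. \<forall>h\<in>H. \<forall>K\<in>Tr h. \<kappa> * h \<le> diameter K)"


section \<open>Finite element spaces\<close>

definition polys :: "nat \<Rightarrow> (real ^ 'd \<Rightarrow> real) set" where
  "polys r = {P. \<exists>c :: ('d \<Rightarrow> nat) \<Rightarrow> real. \<forall>x.
     P x = (\<Sum>\<alpha> | (\<Sum>i\<in>UNIV. \<alpha> i) \<le> r. c \<alpha> * (\<Prod>i\<in>UNIV. (x $ i) ^ \<alpha> i))}"

definition Mh :: "(real ^ 'd) set \<Rightarrow> (real ^ 'd) set set \<Rightarrow> nat \<Rightarrow> (real ^ 'd \<Rightarrow> real) set" where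
  "Mh \<Omega> Tr r = {v. continuous_on \<Omega> v \<and> (\<forall>K\<in>Tr. \<exists>P\<in>polys r. \<forall>x\<in>K. v x = P x)}"

definition Mh0 :: "(real ^ 'd) set \<Rightarrow> (real ^ 'd) set set \<Rightarrow> nat \<Rightarrow> (real ^ 'd \<Rightarrow> real) set" where
  "Mh0 \<Omega> Tr r = Mh \<Omega> Tr r \<inter> H10 \<Omega>"

definition Sh :: "(real ^ 'd) set \<Rightarrow> (real ^ 'd) set set \<Rightarrow> nat \<Rightarrow> (real ^ 'd \<Rightarrow> real) set" where
  "Sh \<Omega> Tr q = Mh \<Omega> Tr q"

definition Sh0 :: "(real ^ 'd) set \<Rightarrow> (real ^ 'd) set set \<Rightarrow> nat \<Rightarrow> (real ^ 'd \<Rightarrow> real) set" where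
  "Sh0 \<Omega> Tr q = Sh \<Omega> Tr q \<inter> L20 \<Omega>"

definition Xh :: "(real ^ 'd) set \<Rightarrow> (real ^ 'd) set set \<Rightarrow> nat \<Rightarrow> (real ^ 'd \<Rightarrow> real ^ 'd) set" where
  "Xh \<Omega> Tr q = {v. \<forall>i. (\<lambda>x. v x $ i) \<in> Mh0 \<Omega> Tr (q + 1)}"

definition Vh :: "(real ^ 'd) set \<Rightarrow> (real ^ 'd) set set \<Rightarrow> nat \<Rightarrow> (real ^ 'd \<Rightarrow> real ^ 'd) set" where
  "Vh \<Omega> Tr q = {v \<in> Xh \<Omega> Tr q. \<forall>w\<in>Sh0 \<Omega> Tr q. ip \<Omega> (divg \<Omega> v) w = 0}"

text \<open>\<open>is_Ritz \<Omega> Tr q \<phi> \<phi>h\<close>: \<open>\<phi>h\<close> is the Ritz projection of \<open>\<phi>\<close>.\<close>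

definition is_Ritz :: "(real ^ 'd) set \<Rightarrow> (real ^ 'd) set set \<Rightarrow> nat \<Rightarrow>
    (real ^ 'd \<Rightarrow> real) \<Rightarrow> (real ^ 'd \<Rightarrow> real) \<Rightarrow> bool" where
  "is_Ritz \<Omega> Tr q \<phi> \<phi>h \<longleftrightarrow> \<phi>h \<in> Sh \<Omega> Tr q \<and>
     (\<forall>\<xi>\<in>Sh \<Omega> Tr q. a_form \<Omega> (\<lambda>x. \<phi>h x - \<phi> x) \<xi> = 0) \<and>
     ip \<Omega> (\<lambda>x. \<phi>h x - \<phi> x) (\<lambda>x. 1) = 0"

text \<open>\<open>is_Stokes \<Omega> Tr q \<eta> u p uh ph\<close>: \<open>(uh, ph)\<close> is the Stokes projection of \<open>(u, p)\<close>.\<close>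

definition is_Stokes :: "(real ^ 'd) set \<Rightarrow> (real ^ 'd) set set \<Rightarrow> nat \<Rightarrow> real \<Rightarrow>
    (real ^ 'd \<Rightarrow> real ^ 'd) \<Rightarrow> (real ^ 'd \<Rightarrow> real) \<Rightarrow>
    (real ^ 'd \<Rightarrow> real ^ 'd) \<Rightarrow> (real ^ 'd \<Rightarrow> real) \<Rightarrow> bool" where
  "is_Stokes \<Omega> Tr q \<eta> u p uh ph \<longleftrightarrow> uh \<in> Vh \<Omega> Tr q \<and> ph \<in> Sh0 \<Omega> Tr q \<and>
     (\<forall>v\<in>Xh \<Omega> Tr q. \<eta> * av_form \<Omega> (\<lambda>x. uh x - u x) v - c_form \<Omega> v (\<lambda>x. ph x - p x) = 0) \<and>
     (\<forall>w\<in>Sh0 \<Omega> Tr q. c_form \<Omega> (\<lambda>x. uh x - u x) w = 0)"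


section \<open>The fully discrete scheme\<close>

text \<open>
  The natural number argument \<open>m\<close> of the following operators stands for the half-integer index
  \<open>m + 1/2\<close>; likewise \<open>\<mu>h m\<close> below is the chemical potential at \<open>m + 1/2\<close>.
\<close>

definition dtau :: "real \<Rightarrow> (nat \<Rightarrow> 'a \<Rightarrow> 'b::real_vector) \<Rightarrow> nat \<Rightarrow> 'a \<Rightarrow> 'b" where
  "dtau \<tau> \<psi> m = (\<lambda>x. (1 / \<tau>) *\<^sub>R (\<psi> (m + 1) x - \<psi> m x))"

definition bar :: "(nat \<Rightarrow> 'a \<Rightarrow> 'b::real_vector) \<Rightarrow> nat \<Rightarrow> 'a \<Rightarrow> 'b" where
  "bar \<psi> m = (\<lambda>x. (1 / 2) *\<^sub>R \<psi> (m + 1) x + (1 / 2) *\<^sub>R \<psi> m x)"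

definition tilde :: "(nat \<Rightarrow> 'a \<Rightarrow> 'b::real_vector) \<Rightarrow> nat \<Rightarrow> 'a \<Rightarrow> 'b" where
  "tilde \<psi> m = (\<lambda>x. (3 / 2) *\<^sub>R \<psi> m x - (1 / 2) *\<^sub>R \<psi> (m - 1) x)"

definition check :: "(nat \<Rightarrow> 'a \<Rightarrow> 'b::real_vector) \<Rightarrow> nat \<Rightarrow> 'a \<Rightarrow> 'b" where
  "check \<psi> m = (\<lambda>x. (3 / 4) *\<^sub>R \<psi> (m + 1) x + (1 / 4) *\<^sub>R \<psi> (m - 1) x)"

definition chi :: "(nat \<Rightarrow> 'a \<Rightarrow> real) \<Rightarrow> nat \<Rightarrow> 'a \<Rightarrow> real" where
  "chi \<phi>h m = (\<lambda>x. 1 / 2 * ((\<phi>h (m + 1) x)\<^sup>2 + (\<phi>h m x)\<^sup>2) * bar \<phi>h m x)"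

definition scheme_step :: "(real ^ 'd) set \<Rightarrow> (real ^ 'd) set set \<Rightarrow> nat \<Rightarrow>
    real \<Rightarrow> real \<Rightarrow> real \<Rightarrow> real \<Rightarrow>
    (nat \<Rightarrow> real ^ 'd \<Rightarrow> real) \<Rightarrow> (nat \<Rightarrow> real ^ 'd \<Rightarrow> real) \<Rightarrow>
    (nat \<Rightarrow> real ^ 'd \<Rightarrow> real ^ 'd) \<Rightarrow> (nat \<Rightarrow> real ^ 'd \<Rightarrow> real) \<Rightarrow> nat \<Rightarrow> bool" where
  "scheme_step \<Omega> Tr q \<epsilon> \<eta> \<gamma> \<tau> \<phi>h \<mu>h uh ph m \<longleftrightarrow>
     \<phi>h (m + 1) \<in> Sh \<Omega> Tr q \<and> \<mu>h m \<in> Sh \<Omega> Tr q \<and>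
     uh (m + 1) \<in> Xh \<Omega> Tr q \<and> ph (m + 1) \<in> Sh0 \<Omega> Tr q \<and>
     (\<forall>\<nu>\<in>Sh \<Omega> Tr q.
        ip \<Omega> (dtau \<tau> \<phi>h m) \<nu> + \<epsilon> * a_form \<Omega> (\<mu>h m) \<nu>
        + b_form \<Omega> (tilde \<phi>h m) (bar uh m) \<nu> = 0) \<and>
     (\<forall>\<psi>\<in>Sh \<Omega> Tr q.
        1 / \<epsilon> * ip \<Omega> (chi \<phi>h m) \<psi> - 1 / \<epsilon> * ip \<Omega> (tilde \<phi>h m) \<psi>
        + \<epsilon> * a_form \<Omega> (check \<phi>h m) \<psi> - ip \<Omega> (\<mu>h m) \<psi> = 0) \<and>
     (\<forall>v\<in>Xh \<Omega> Tr q.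
        ip \<Omega> (dtau \<tau> uh m) v + \<eta> * av_form \<Omega> (bar uh m) v
        + B_form \<Omega> (tilde uh m) (bar uh m) v - c_form \<Omega> v (bar ph m)
        - \<gamma> * b_form \<Omega> (tilde \<phi>h m) v (\<mu>h m) = 0) \<and>
     (\<forall>w\<in>Sh0 \<Omega> Tr q. c_form \<Omega> (bar uh m) w = 0)"


section \<open>Energies\<close>

definition energy :: "(real ^ 'd) set \<Rightarrow> real \<Rightarrow> real \<Rightarrow>
    (real ^ 'd \<Rightarrow> real) \<Rightarrow> (real ^ 'd \<Rightarrow> real ^ 'd) \<Rightarrow> real" where
  "energy \<Omega> \<epsilon> \<gamma> \<phi> u =
     (LINT x:\<Omega>|lebesgue. 1 / (4 * \<epsilon>) * ((\<phi> x)\<^sup>2 - 1)\<^sup>2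
        + \<epsilon> / 2 * (norm (grad \<Omega> \<phi> x))\<^sup>2 + 1 / (2 * \<gamma>) * (norm (u x))\<^sup>2)"

definition mod_energy :: "(real ^ 'd) set \<Rightarrow> real \<Rightarrow> real \<Rightarrow>
    (real ^ 'd \<Rightarrow> real) \<Rightarrow> (real ^ 'd \<Rightarrow> real) \<Rightarrow> (real ^ 'd \<Rightarrow> real ^ 'd) \<Rightarrow> real" where
  "mod_energy \<Omega> \<epsilon> \<gamma> \<phi> \<psi> u = energy \<Omega> \<epsilon> \<gamma> \<phi> u
     + 1 / (4 * \<epsilon>) * (nrm \<Omega> (\<lambda>x. \<phi> x - \<psi> x))\<^sup>2
     + \<epsilon> / 8 * (nrm \<Omega> (\<lambda>x. grad \<Omega> \<phi> x - grad \<Omega> \<psi> x))\<^sup>2"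

end

theory Submission
  imports Defs "HOL-Real_Asymp.Real_Asymp"
begin

text \<open>
  The energy law comes from testing the four equations of one time step with
  \<open>\<mu>h\<close>, \<open>\<delta>\<^sub>\<tau>\<phi>h\<close>, \<open>bar uh / \<gamma>\<close> and \<open>bar ph\<close>. In the sum the convection terms \<open>b_form\<close> of the
  phase and the momentum equation cancel, the skew form \<open>B_form\<close> vanishes on the diagonal, and the
  pressure term vanishes because \<open>bar uh\<close> is discretely divergence free. What is left are
  dissipation terms and three telescoping ones: \<open>(chi - tilde, \<delta>\<^sub>\<tau>\<phi>h)\<close>, \<open>a_form check \<delta>\<^sub>\<tau>\<phi>h\<close> and
  \<open>(\<delta>\<^sub>\<tau>uh, bar uh)\<close>. The last is an exact difference of kinetic energies, and each of the others is a
  difference of modified energies plus the square of a second difference, by pointwise algebra (\<open>double_well_identity\<close>, \<open>gradient_identity\<close>, \<open>kinetic_identity\<close>);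
  \<open>scheme_step_energy\<close> collects them, and the theorem is the sum over the time steps.

  The analytic content is in the word "testing". The gradient is an arbitrarily chosen weak
  gradient, so \<open>a_form\<close> may be expanded bilinearly only once it is known that the functions involved
  have a weak gradient and that this gradient is unique almost everywhere.

  Uniqueness (\<open>has_weak_grad_unique\<close>) is the fundamental lemma of the calculus of variations. Smooth
  bumps built from \<open>exp (- 1 / t)\<close> converge boundedly to the indicator of any open box in \<open>\<Omega>\<close>, so a
  function orthogonal to all test functions has integral zero over all these boxes, hence, as boxes
  generate the Borel sets, over all Borel subsets of such a box.

  Existence (\<open>piecewise_C1_in_H1\<close>) is obtained from difference quotients instead of integration by
  parts on each cell. A function that is \<open>C\<^sup>1\<close> on each of finitely many compact convex cells covering
  \<open>\<Omega>\<close> is Lipschitz along the coordinate segments in \<open>\<Omega>\<close>. Its difference quotients are therefore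
  bounded, and they converge off the null set of cell boundaries, so that dominated convergence turns
  discrete summation by parts, which is just translation invariance, into the weak
  derivative identity. The same lemma, with one large ball as the only cell, puts test functions into
  \<open>H1\<close>; this is what makes \<open>H10\<close> closed under midpoints (\<open>H10_midpoint\<close>) and so \<open>bar uh\<close> an
  admissible velocity test function.
\<close>

section \<open>Calculus of continuously differentiable functions\<close>

lemma C_k_Suc_imp_C_k: "C_k (Suc k) f \<Longrightarrow> C_k k f"
proof (induction k arbitrary: f)
  case 0
  then show ?case
    by (simp add: differentiable_imp_continuous_on)
next
  case (Suc k)
  then show ?case
    by (auto simp del: C_k.simps simp: C_k.simps(2)[of "Suc k"] C_k.simps(2)[of k])
qed

lemma C_k_continuous: "C_k k f \<Longrightarrow> continuous_on UNIV f"
  by (cases k) (auto simp: differentiable_imp_continuous_on)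

lemma C_k_continuous_on: "C_k k f \<Longrightarrow> continuous_on S f"
  using C_k_continuous continuous_on_subset by blast

text \<open>
  Introducing \<open>C_k (Suc k)\<close> with an explicitly given derivative keeps \<^const>\<open>frechet_derivative\<close> out of
  the closure proofs below.
\<close>

lemma C_k_SucI:
  assumes "\<And>x. (f has_derivative f' x) (at x)"
    and "\<And>b. b \<in> Basis \<Longrightarrow> C_k k (\<lambda>x. f' x b)"
  shows "C_k (Suc k) f"
proof -
  have "frechet_derivative f (at x) = f' x" for x
    using frechet_derivative_at[OF assms(1)] by simp
  moreover have "f differentiable_on UNIV"
    using assms(1) by (auto simp: differentiable_on_def differentiable_def)
  ultimately show ?thesis
    using assms(2) by simp
qed

lemma C_k_Suc_has_derivative:
  assumes "C_k (Suc k) f"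
  shows "(f has_derivative frechet_derivative f (at x)) (at x)"
  using assms by (simp add: differentiable_on_def frechet_derivative_works[symmetric])

lemma C_k_const: "C_k k (\<lambda>x. c)"
proof (induction k arbitrary: c)
  case 0
  show ?case by simp
next
  case (Suc k)
  show ?case
    by (rule C_k_SucI[where f'="\<lambda>_ _. 0"]) (use Suc in auto)
qed

lemma C_k_add: "C_k k f \<Longrightarrow> C_k k g \<Longrightarrow> C_k k (\<lambda>x. f x + g x)"
proof (induction k arbitrary: f g)
  case 0
  then show ?case by (simp add: continuous_on_add)
next
  case (Suc k)
  show ?case
    by (rule C_k_SucI[OF has_derivative_add[OF C_k_Suc_has_derivative[OF Suc.prems(1)]
            C_k_Suc_has_derivative[OF Suc.prems(2)]]])
       (use Suc in auto)
qed

lemma C_k_mult: "C_k k f \<Longrightarrow> C_k k g \<Longrightarrow> C_k k (\<lambda>x. f x * g x)"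
proof (induction k arbitrary: f g)
  case 0
  then show ?case by (simp add: continuous_on_mult)
next
  case (Suc k)
  have "C_k k f" "C_k k g"
    using Suc.prems C_k_Suc_imp_C_k by blast+
  then show ?case
    using Suc
    by (intro C_k_SucI[OF has_derivative_mult[OF C_k_Suc_has_derivative[OF Suc.prems(1)]
            C_k_Suc_has_derivative[OF Suc.prems(2)]]] C_k_add) auto
qed

lemma C_k_sum: "(\<And>i. i \<in> I \<Longrightarrow> C_k k (f i)) \<Longrightarrow> C_k k (\<lambda>x. \<Sum>i\<in>I. f i x)"
  by (induction I rule: infinite_finite_induct) (auto intro: C_k_const C_k_add)

lemma C_k_prod: "(\<And>i. i \<in> I \<Longrightarrow> C_k k (f i)) \<Longrightarrow> C_k k (\<lambda>x. \<Prod>i\<in>I. f i x)"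
  by (induction I rule: infinite_finite_induct) (auto intro: C_k_const C_k_mult)

lemma C_k_power: "C_k k f \<Longrightarrow> C_k k (\<lambda>x. f x ^ n)"
  by (induction n) (auto intro: C_k_const C_k_mult)

lemma C_k_inner: "C_k k (\<lambda>x. x \<bullet> b)"
proof (cases k)
  case 0
  then show ?thesis by (simp add: continuous_intros)
next
  case (Suc m)
  have "((\<lambda>x. x \<bullet> b) has_derivative (\<lambda>h. h \<bullet> b)) (at x)" for x
    by (rule bounded_linear_imp_has_derivative) (rule bounded_linear_inner_left)
  from C_k_SucI[OF this C_k_const] Suc show ?thesis by simp
qed

section \<open>Smooth bumps\<close>

text \<open>
  The functions \<open>t\<^sup>-\<^sup>j exp (- 1 / t)\<close>, extended by \<open>0\<close> to \<open>t \<le> 0\<close>. Carrying the power \<open>j\<close> makes the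
  derivative of a member a combination of members, so that smoothness of all of them follows by one
  induction on the order of differentiability.
\<close>

definition flat_exp :: "nat \<Rightarrow> real \<Rightarrow> real" where
  "flat_exp j t = (if t \<le> 0 then 0 else (1 / t) ^ j * exp (- (1 / t)))"

text \<open>
  In terms of \<open>y = 1 / t\<close> this is the decay of \<open>y\<^sup>j / exp y\<close> as \<open>y\<close> tends to infinity.
\<close>

lemma tendsto_flat_exp_0: "(flat_exp j \<longlongrightarrow> 0) (at 0)"
proof -
  have 1: "((\<lambda>t. (inverse t) ^ j / exp (inverse t)) \<longlongrightarrow> (0::real)) (at_right 0)"
    by (rule filterlim_compose[OF tendsto_power_div_exp_0 filterlim_inverse_at_top_right])
  have "(flat_exp j \<longlongrightarrow> 0) (at_right 0)"
  proof (rule Lim_transform_eventually[OF 1])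
    show "\<forall>\<^sub>F t in at_right 0. inverse t ^ j / exp (inverse t) = flat_exp j t"
      using eventually_at_right_less[of "0::real"]
      by eventually_elim (simp add: flat_exp_def exp_minus divide_inverse)
  qed
  moreover have "(flat_exp j \<longlongrightarrow> 0) (at_left 0)"
  proof (rule Lim_transform_eventually[OF tendsto_const])
    show "\<forall>\<^sub>F t in at_left 0. 0 = flat_exp j t"
      by (auto simp: eventually_at_left_field flat_exp_def intro!: exI[of _ "-1"])
  qed
  ultimately show ?thesis
    by (simp add: filterlim_split_at)
qed

text \<open>
  The only delicate point is \<open>t = 0\<close>, where the difference quotient of \<open>flat_exp j\<close> is
  \<open>flat_exp (Suc j)\<close>, which tends to \<open>0\<close>.
\<close>

lemma flat_exp_has_real_derivative:
  "(flat_exp j has_real_derivative flat_exp (j + 2) t - real j * flat_exp (j + 1) t) (at t)"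
proof -
  consider "t < 0" | "t = 0" | "t > 0" by linarith
  then show ?thesis
  proof cases
    case 1
    have "((\<lambda>_. 0) has_real_derivative 0) (at t)" by simp
    then have "(flat_exp j has_real_derivative 0) (at t)"
      by (rule has_field_derivative_transform_within_open[where S="{..<0}"])
         (use 1 in \<open>auto simp: flat_exp_def\<close>)
    then show ?thesis using 1 by (simp add: flat_exp_def)
  next
    case 2
    have "((\<lambda>y. (flat_exp j y - flat_exp j 0) / (y - 0)) \<longlongrightarrow> 0) (at 0)"
      by (rule Lim_transform_eventually[OF tendsto_flat_exp_0[of "Suc j"]])
         (auto simp: eventually_at_filter flat_exp_def)
    then show ?thesis
      using 2 by (simp add: has_field_derivative_iff flat_exp_def)
  next
    case 3
    have y: "((\<lambda>t. 1 / t) has_real_derivative - ((1 / t) ^ 2)) (at t)"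
      using 3 by (auto intro!: derivative_eq_intros simp: power2_eq_square)
    have e: "((\<lambda>t. exp (- (1 / t))) has_real_derivative exp (- (1 / t)) * (1 / t) ^ 2) (at t)"
      using DERIV_fun_exp[OF DERIV_minus[OF y]] by simp
    have j: "real j * ((1 / t) ^ 2 * (1 / t) ^ (j - 1)) = real j * (1 / t) ^ (j + 1)"
      by (cases j) (simp_all add: power2_eq_square)
    have cong: "real j * (1 / t) ^ (j - Suc 0) * (- ((1 / t) ^ 2)) * exp (- (1 / t))
        + exp (- (1 / t)) * (1 / t) ^ 2 * (1 / t) ^ j
        = flat_exp (j + 2) t - real j * flat_exp (j + 1) t"
      (is "?l = _")
    proof -
      have "?l = exp (- (1 / t)) * (1 / t) ^ (j + 2)
          - real j * ((1 / t) ^ 2 * (1 / t) ^ (j - 1)) * exp (- (1 / t))"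
        unfolding power_add One_nat_def by algebra
      then show ?thesis
        unfolding j using 3 by (simp add: flat_exp_def mult_ac)
    qed
    have "((\<lambda>t. (1 / t) ^ j * exp (- (1 / t))) has_real_derivative
        flat_exp (j + 2) t - real j * flat_exp (j + 1) t) (at t)"
      by (rule DERIV_cong[OF DERIV_mult[OF DERIV_power[OF y] e]])
         (simp only: cong[symmetric], simp only: mult_ac)
    then show ?thesis
      by (rule has_field_derivative_transform_within_open[where S="{0<..}"])
         (use 3 in \<open>auto simp: flat_exp_def\<close>)
  qed
qed

text \<open>
  The affine argument covers both the rising and the falling side of a bump in the coordinate \<open>b\<close>.
\<close>

lemma C_k_flat_exp:
  fixes b :: "'a::euclidean_space"
  shows "C_k k (\<lambda>x. flat_exp j (c * (x \<bullet> b) + d))"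
proof (induction k arbitrary: j)
  case 0
  have "continuous_on UNIV (flat_exp j)"
    by (rule DERIV_continuous_on[OF flat_exp_has_real_derivative])
  moreover have "continuous_on UNIV (\<lambda>x::'a. c * (x \<bullet> b) + d)"
    by (intro continuous_intros)
  ultimately show ?case
    by (auto intro: continuous_on_compose2[where g="flat_exp j"])
next
  case (Suc k)
  let ?D = "\<lambda>x. flat_exp (j + 2) (c * (x \<bullet> b) + d) - real j * flat_exp (j + 1) (c * (x \<bullet> b) + d)"
  show ?case
  proof (rule C_k_SucI)
    fix x :: 'a
    have "((\<lambda>x. c * (x \<bullet> b) + d) has_derivative (\<lambda>h. c * (h \<bullet> b))) (at x)"
      by (auto intro!: derivative_eq_intros)
    from has_derivative_compose[OF this
        flat_exp_has_real_derivative[unfolded has_field_derivative_def]]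
    show "((\<lambda>x. flat_exp j (c * (x \<bullet> b) + d)) has_derivative (\<lambda>h. ?D x * (c * (h \<bullet> b)))) (at x)" .
  next
    fix e :: 'a
    have eq: "?D x * (c * (e \<bullet> b)) = (flat_exp (j + 2) (c * (x \<bullet> b) + d)
        + (- real j) * flat_exp (j + 1) (c * (x \<bullet> b) + d)) * (c * (e \<bullet> b))" for x
      by simp
    show "C_k k (\<lambda>x. ?D x * (c * (e \<bullet> b)))"
      unfolding eq by (intro C_k_mult C_k_add C_k_const Suc)
  qed
qed

text \<open>
  The bumps are products over the coordinates of \<open>exp (- 1 / (n t - 1))\<close>, where \<open>t\<close> is the distance to
  a face of the box. The factor \<open>n\<close> makes them increase to \<open>1\<close> inside the box; the shift by \<open>1\<close> makes
  them vanish already at distance \<open>1 / n\<close> from the boundary. Thus their supports are compact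
  subsets of the open box, and \<open>\<Omega>\<close> need not contain the closed one.
\<close>

lemma test_functions_indicator_box:
  fixes a b :: "'a::euclidean_space"
  assumes sub: "box a b \<subseteq> \<Omega>"
  obtains \<theta> where "\<And>n. \<theta> n \<in> test_functions \<Omega>" "\<And>n x. \<bar>\<theta> n x\<bar> \<le> 1"
    "\<And>x. (\<lambda>n. \<theta> n x) \<longlonglongrightarrow> indicator (box a b) x"
proof
  let ?r = "\<lambda>n. real (Suc n)"
  define s where "s n t = flat_exp 0 (?r n * t - 1)" for n t
  define \<theta> where "\<theta> n x = (\<Prod>i\<in>Basis. s n (x \<bullet> i - a \<bullet> i) * s n (b \<bullet> i - x \<bullet> i))"
    for n and x :: 'a
  have s01: "0 \<le> s n t \<and> s n t \<le> 1" for n t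
    by (auto simp: s_def flat_exp_def)
  have s0: "s n t = 0" if "t \<le> 1 / ?r n" for n t
  proof -
    have "?r n * t \<le> 1" using that by (simp add: field_simps)
    then show ?thesis by (simp add: s_def flat_exp_def)
  qed
  show "\<bar>\<theta> n x\<bar> \<le> 1" for n x
    unfolding \<theta>_def abs_prod using s01 by (intro prod_le_1) (auto simp: abs_mult intro: mult_le_one)
  show "\<theta> n \<in> test_functions \<Omega>" for n
  proof -
    have "C_k k (\<theta> n)" for k
    proof -
      have "\<theta> n = (\<lambda>x. \<Prod>i\<in>Basis. flat_exp 0 (?r n * (x \<bullet> i) + (- ?r n * (a \<bullet> i) - 1))
          * flat_exp 0 ((- ?r n) * (x \<bullet> i) + (?r n * (b \<bullet> i) - 1)))"
        by (auto simp: \<theta>_def s_def fun_eq_iff algebra_simps)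
      then show ?thesis
        by (auto intro!: C_k_prod C_k_mult C_k_flat_exp)
    qed
    moreover have supp: "{x. \<theta> n x \<noteq> 0} \<subseteq> cbox (a + (1 / ?r n) *\<^sub>R One) (b - (1 / ?r n) *\<^sub>R One)"
    proof (clarsimp simp: mem_box inner_simps)
      fix x i assume nz: "\<theta> n x \<noteq> 0" and i: "i \<in> (Basis :: 'a set)"
      have "s n (x \<bullet> i - a \<bullet> i) \<noteq> 0" "s n (b \<bullet> i - x \<bullet> i) \<noteq> 0"
        using nz i by (auto simp: \<theta>_def)
      then have "\<not> x \<bullet> i - a \<bullet> i \<le> 1 / ?r n" "\<not> b \<bullet> i - x \<bullet> i \<le> 1 / ?r n"
        using s0 by blast+
      then show "a \<bullet> i + 1 / (1 + real n) \<le> x \<bullet> i \<and> x \<bullet> i \<le> b \<bullet> i - 1 / (1 + real n)"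
        by (simp add: add.commute)
    qed
    moreover have "closure {x. \<theta> n x \<noteq> 0} \<subseteq> cbox (a + (1 / ?r n) *\<^sub>R One) (b - (1 / ?r n) *\<^sub>R One)"
      using supp by (rule closure_minimal) (rule closed_cbox)
    moreover have "cbox (a + (1 / ?r n) *\<^sub>R One) (b - (1 / ?r n) *\<^sub>R One) \<subseteq> box a b"
    proof
      fix x assume x: "x \<in> cbox (a + (1 / ?r n) *\<^sub>R One) (b - (1 / ?r n) *\<^sub>R One)"
      show "x \<in> box a b"
        unfolding mem_box
      proof (intro ballI)
        fix i :: 'a assume i: "i \<in> Basis"
        have "a \<bullet> i + 1 / ?r n \<le> x \<bullet> i" "x \<bullet> i \<le> b \<bullet> i - 1 / ?r n" "0 < 1 / ?r n"
          using x i by (auto simp: mem_box inner_simps simp del: of_nat_Suc)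
        then show "a \<bullet> i < x \<bullet> i \<and> x \<bullet> i < b \<bullet> i" by linarith
      qed
    qed
    moreover have "compact (closure {x. \<theta> n x \<noteq> 0})"
      using bounded_subset[OF bounded_cbox supp] by (simp add: compact_closure)
    ultimately show ?thesis
      using sub by (auto simp: test_functions_def)
  qed
  show "(\<lambda>n. \<theta> n x) \<longlonglongrightarrow> indicator (box a b) x" for x
  proof (cases "x \<in> box a b")
    case False
    then obtain i where i: "i \<in> Basis" "x \<bullet> i - a \<bullet> i \<le> 0 \<or> b \<bullet> i - x \<bullet> i \<le> 0"
      by (auto simp: mem_box not_less)
    have "0 \<le> 1 / ?r n" for n by simp
    with i(2) have "s n (x \<bullet> i - a \<bullet> i) = 0 \<or> s n (b \<bullet> i - x \<bullet> i) = 0" for n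
      by (meson order_trans s0)
    then have "\<theta> n x = 0" for n
      unfolding \<theta>_def using i(1) by (intro prod_zero) auto
    with False show ?thesis by simp
  next
    case True
    have s1: "(\<lambda>n. s n t) \<longlonglongrightarrow> 1" if t: "0 < t" for t
    proof -
      have lim: "filterlim (\<lambda>n. ?r n * t - 1) at_top sequentially"
        using t by real_asymp
      have "((\<lambda>z::real. exp (- (1 / z))) \<longlongrightarrow> 1) at_top"
        by real_asymp
      then have "(\<lambda>n. exp (- (1 / (?r n * t - 1)))) \<longlonglongrightarrow> 1"
        using lim by (rule filterlim_compose)
      then show ?thesis
      proof (rule Lim_transform_eventually)
        have "\<forall>\<^sub>F n in sequentially. 0 < ?r n * t - 1"
          using lim by (rule filterlim_at_top_dense[THEN iffD1, rule_format])
        then show "\<forall>\<^sub>F n in sequentially. exp (- (1 / (?r n * t - 1))) = s n t"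
          by eventually_elim (simp add: s_def flat_exp_def)
      qed
    qed
    have "(\<lambda>n. \<theta> n x) \<longlonglongrightarrow> (\<Prod>i\<in>(Basis::'a set). 1 * 1)"
      unfolding \<theta>_def using True by (intro tendsto_prod tendsto_mult s1) (auto simp: mem_box)
    with True show ?thesis by simp
  qed
qed

lemma test_functions_borel: "\<theta> \<in> test_functions \<Omega> \<Longrightarrow> \<theta> \<in> borel_measurable borel"
  using C_k_continuous[of 0 \<theta>] by (auto simp: test_functions_def intro: borel_measurable_continuous_onI)

section \<open>The fundamental lemma of the calculus of variations\<close>

lemma borel_imp_lebesgue: "f \<in> borel_measurable borel \<Longrightarrow> f \<in> borel_measurable lebesgue"
  by (simp add: measurable_completion)

text \<open>
  The sets over which \<open>f\<close> has integral zero form a Dynkin system, and the open boxes are an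
  intersection-stable generator of the Borel sets.
\<close>

lemma AE_0_if_integral_boxes_0:
  fixes f :: "'a::euclidean_space \<Rightarrow> real"
  assumes f: "integrable lborel f"
    and box0: "\<And>a b. (LINT x:box a b|lborel. f x) = 0"
    and total0: "(LINT x|lborel. f x) = 0"
  shows "AE x in lborel. f x = 0"
proof (rule density_unique_real[OF f])
  show "integrable lborel (\<lambda>_::'a. 0::real)" by simp
  have fi: "set_integrable lborel A f" if "A \<in> sets borel" for A
    using integrable_mult_indicator[OF _ f, of A] that by (simp add: set_integrable_def)
  fix A :: "'a set" assume A: "A \<in> sets lborel"
  have "Int_stable (range (\<lambda>(a, b). box a b :: 'a set))"
    by (auto simp: Int_stable_def box_Int_box)
  moreover have "(range (\<lambda>(a, b). box a b :: 'a set)) \<subseteq> Pow UNIV"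
    by auto
  moreover have "A \<in> sigma_sets UNIV (range (\<lambda>(a, b). box a b))"
    using A unfolding sets_lborel borel_eq_box by simp
  ultimately have "(LINT x:A|lborel. f x) = 0"
  proof (induction rule: sigma_sets_induct_disjoint)
    case (basic A)
    then show ?case using box0 by auto
  next
    case empty
    show ?case by (simp add: set_lebesgue_integral_def)
  next
    case (compl A)
    then have [measurable]: "A \<in> sets borel"
      by (simp add: borel_eq_box)
    have "(LINT x:A \<union> (UNIV - A)|lborel. f x) = (LINT x:A|lborel. f x) + (LINT x:UNIV - A|lborel. f x)"
      by (rule set_integral_Un) (auto intro!: fi)
    with compl total0 show ?case
      by (simp add: set_lebesgue_integral_def)
  next
    case (union F)
    then have [measurable]: "F i \<in> sets borel" for i
      by (simp add: borel_eq_box subset_eq)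
    have "(LINT x:(\<Union>i. F i)|lborel. f x) = (\<Sum>i. LINT x:F i|lborel. f x)"
      by (rule lebesgue_integral_countable_add)
         (use union(1) in \<open>auto intro!: fi simp: disjoint_family_on_def\<close>)
    with union show ?case by simp
  qed
  then show "(LINT x:A|lborel. f x) = (LINT x:A|lborel. 0)"
    by simp
qed

text \<open>
  By bounded approximation of indicators the integral of \<open>g\<close> over every open box in \<open>\<Omega>\<close> vanishes.
  Localising to one such box \<open>Q\<close>, the integral of \<open>g\<close> on \<open>Q\<close> over an arbitrary box is again one over a
  box in \<open>\<Omega>\<close>, so \<open>g\<close> vanishes almost everywhere on \<open>Q\<close>; countably many \<open>Q\<close> exhaust \<open>\<Omega>\<close>. A Borel
  representative of \<open>g\<close> stands in for the Lebesgue measurable function in the argument about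
  generators.
\<close>

lemma test_functions_fundamental:
  fixes g :: "'a::euclidean_space \<Rightarrow> real"
  assumes \<Omega>: "open \<Omega>" and g: "set_integrable lebesgue \<Omega> g"
    and orth: "\<And>\<theta>. \<theta> \<in> test_functions \<Omega> \<Longrightarrow> (LINT x:\<Omega>|lebesgue. g x * \<theta> x) = 0"
  shows "AE x in lebesgue. x \<in> \<Omega> \<longrightarrow> g x = 0"
proof -
  define G where "G x = indicator \<Omega> x * g x" for x
  have G: "integrable lebesgue G"
    using g by (simp add: set_integrable_def G_def[abs_def])
  then have "G \<in> borel_measurable lebesgue" by simp
  then obtain G' where G'[measurable]: "G' \<in> borel_measurable lborel" and ae: "AE x in lborel. G x = G' x"
    using completion_ex_borel_measurable_real by blast
  have ae': "AE x in lebesgue. G x = G' x"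
    using ae by (rule AE_completion)
  have iG': "integrable lborel G'"
    using integrable_completion[OF G'] integrable_cong_AE[OF _ _ ae'] G measurable_completion[OF G']
    by simp
  have box: "(LINT x:box a b|lborel. G' x) = 0" if sub: "box a b \<subseteq> \<Omega>" for a b
  proof -
    obtain \<theta> where \<theta>: "\<And>n. \<theta> n \<in> test_functions \<Omega>" "\<And>n x. \<bar>\<theta> n x\<bar> \<le> 1"
      "\<And>x. (\<lambda>n. \<theta> n x) \<longlonglongrightarrow> indicator (box a b) x"
      using test_functions_indicator_box[OF sub] by blast
    have \<theta>m: "\<theta> n \<in> borel_measurable lebesgue" for n
      using \<theta>(1) by (intro borel_imp_lebesgue test_functions_borel)
    have "(\<lambda>n. LINT x|lebesgue. G x * \<theta> n x) \<longlonglongrightarrow> (LINT x|lebesgue. G x * indicator (box a b) x)"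
    proof (rule integral_dominated_convergence[where w="\<lambda>x. norm (G x)"])
      show "integrable lebesgue (\<lambda>x. norm (G x))" using G by simp
      show "(\<lambda>x. G x * \<theta> n x) \<in> borel_measurable lebesgue" for n
        using \<theta>m G by simp
      show "(\<lambda>x. G x * indicator (box a b) x) \<in> borel_measurable lebesgue"
        using G by (intro borel_measurable_times borel_imp_lebesgue[of "indicator (box a b)"]) auto
      show "AE x in lebesgue. (\<lambda>n. G x * \<theta> n x) \<longlonglongrightarrow> G x * indicator (box a b) x"
        by (auto intro!: tendsto_mult \<theta>)
      show "AE x in lebesgue. norm (G x * \<theta> n x) \<le> norm (G x)" for n
        using \<theta>(2) by (auto simp: abs_mult intro!: mult_left_le)
    qed
    moreover have "(LINT x|lebesgue. G x * \<theta> n x) = 0" for n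
      using orth[OF \<theta>(1)] by (simp add: set_lebesgue_integral_def G_def mult.assoc)
    ultimately have "(\<lambda>n::nat. 0) \<longlonglongrightarrow> (LINT x|lebesgue. G x * indicator (box a b) x)"
      by simp
    then have "(LINT x|lebesgue. G x * indicator (box a b) x) = 0"
      by (simp add: LIMSEQ_const_iff)
    moreover have "(LINT x|lebesgue. G x * indicator (box a b) x)
        = (LINT x|lebesgue. indicator (box a b) x * G' x)"
    proof (rule integral_cong_AE)
      show "(\<lambda>x. G x * indicator (box a b) x) \<in> borel_measurable lebesgue"
        using G by (intro borel_measurable_times borel_imp_lebesgue[of "indicator (box a b)"]) auto
      show "(\<lambda>x. indicator (box a b) x * G' x) \<in> borel_measurable lebesgue"
        by (rule measurable_completion) simp
      show "AE x in lebesgue. G x * indicator (box a b) x = indicator (box a b) x * G' x"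
        using ae' by eventually_elim simp
    qed
    moreover have "\<dots> = (LINT x|lborel. indicator (box a b) x * G' x)"
      by (rule integral_completion) simp
    ultimately show ?thesis
      by (simp add: set_lebesgue_integral_def)
  qed
  have box0: "AE x in lborel. indicator (box a b) x * G' x = 0" if sub: "box a b \<subseteq> \<Omega>" for a b
  proof (rule AE_0_if_integral_boxes_0)
    show "integrable lborel (\<lambda>x. indicator (box a b) x * G' x)"
      using integrable_mult_indicator[OF _ iG'] by simp
    show "(LINT x|lborel. indicator (box a b) x * G' x) = 0"
      using box[OF sub] by (simp add: set_lebesgue_integral_def)
    fix c d
    obtain e f where ef: "box c d \<inter> box a b = box e f"
      by (auto simp: box_Int_box)
    have "(LINT x:box c d|lborel. indicator (box a b) x * G' x) = (LINT x:box e f|lborel. G' x)"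
      unfolding ef[symmetric] by (simp add: set_lebesgue_integral_def indicator_inter_arith mult.assoc)
    also have "\<dots> = 0"
      using sub ef by (intro box) auto
    finally show "(LINT x:box c d|lborel. indicator (box a b) x * G' x) = 0" .
  qed
  obtain \<D> where \<D>: "countable \<D>" "\<D> \<subseteq> Pow \<Omega>" "\<And>X. X \<in> \<D> \<Longrightarrow> \<exists>a b. X = box a b" "\<Union>\<D> = \<Omega>"
    using open_countable_Union_open_box[OF \<Omega>] by blast
  have "AE x in lborel. \<forall>X\<in>\<D>. indicator X x * G' x = 0"
    using \<D>(2,3) box0 by (intro AE_ball_countable'[OF _ \<D>(1)]) blast
  then have "AE x in lebesgue. \<forall>X\<in>\<D>. indicator X x * G' x = 0"
    by (rule AE_completion)
  with ae' show ?thesis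
  proof eventually_elim
    case (elim x)
    show ?case
    proof
      assume x: "x \<in> \<Omega>"
      then obtain X where "X \<in> \<D>" "x \<in> X" using \<D>(4) by blast
      with elim x show "g x = 0" by (auto simp: G_def)
    qed
  qed
qed

section \<open>Continuous piecewise smooth functions are weakly differentiable\<close>

text \<open>
  The mean value theorem along lines parallel to \<open>e\<close>, with the maximum of the partial derivative on the
  compact set \<open>K\<close> as constant; it is uniform in the line.
\<close>

lemma C1_line_lipschitz:
  assumes P: "C_k 1 P" and K: "compact K" "convex K" and e: "e \<in> Basis"
  obtains L where "0 \<le> L" "\<And>x. L-lipschitz_on {t. x + t *\<^sub>R e \<in> K} (\<lambda>t. P (x + t *\<^sub>R e))"
proof -
  let ?D = "\<lambda>x. frechet_derivative P (at x) e"
  have "continuous_on UNIV ?D"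
    using P e by simp
  then have "bounded (?D ` K)"
    using K by (intro compact_imp_bounded compact_continuous_image) (auto intro: continuous_on_subset)
  then obtain L where L: "\<And>x. x \<in> K \<Longrightarrow> norm (?D x) \<le> L"
    by (auto simp: bounded_iff)
  show thesis
  proof (rule that[of "max 0 L"])
    fix x
    let ?S = "{t. x + t *\<^sub>R e \<in> K}"
    have conv: "convex ?S"
    proof (rule convexI)
      fix t r u w :: real
      assume *: "t \<in> ?S" "r \<in> ?S" "0 \<le> u" "0 \<le> w" "u + w = 1"
      have "x + (u *\<^sub>R t + w *\<^sub>R r) *\<^sub>R e = (u + w) *\<^sub>R x + (u *\<^sub>R t + w *\<^sub>R r) *\<^sub>R e"
        using * by simp
      also have "\<dots> = u *\<^sub>R (x + t *\<^sub>R e) + w *\<^sub>R (x + r *\<^sub>R e)"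
        by (simp add: algebra_simps)
      also have "\<dots> \<in> K"
        using * K(2) by (auto intro!: convexD)
      finally show "u *\<^sub>R t + w *\<^sub>R r \<in> ?S" by simp
    qed
    have der: "((\<lambda>t. P (x + t *\<^sub>R e)) has_field_derivative ?D (x + t *\<^sub>R e)) (at t within ?S)" for t
    proof -
      have 1: "((\<lambda>t. x + t *\<^sub>R e) has_derivative (\<lambda>h. h *\<^sub>R e)) (at t within ?S)"
        by (auto intro!: derivative_eq_intros)
      have 2: "(P has_derivative frechet_derivative P (at (x + t *\<^sub>R e))) (at (x + t *\<^sub>R e))"
        using P by (intro C_k_Suc_has_derivative[of 0]) simp
      from has_derivative_compose[OF 1 2]
      have "((\<lambda>t. P (x + t *\<^sub>R e)) has_derivative
          (\<lambda>h. frechet_derivative P (at (x + t *\<^sub>R e)) (h *\<^sub>R e))) (at t within ?S)" .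
      moreover have "linear (frechet_derivative P (at (x + t *\<^sub>R e)))"
        by (rule has_derivative_linear[OF 2])
      ultimately show ?thesis
        by (simp add: has_field_derivative_def linear_scale mult.commute[of _ "?D _"])
    qed
    show "(max 0 L)-lipschitz_on ?S (\<lambda>t. P (x + t *\<^sub>R e))"
    proof (rule lipschitz_onI)
      fix t r assume "t \<in> ?S" "r \<in> ?S"
      then show "dist (P (x + t *\<^sub>R e)) (P (x + r *\<^sub>R e)) \<le> max 0 L * dist t r"
        unfolding dist_norm using L
        by (intro field_differentiable_bound[OF conv der]) (auto intro: max.coboundedI2)
    qed simp
  qed simp
qed

text \<open>
  The cells may overlap: agreement with a \<open>C\<^sup>1\<close> function on each closed cell is all that the
  difference quotient argument uses. This covers finite element functions and, with a single cell,
  globally smooth functions.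
\<close>

definition piecewise_C1 :: "'a::euclidean_space set set \<Rightarrow> ('a \<Rightarrow> real) \<Rightarrow> bool" where
  "piecewise_C1 \<K> v \<longleftrightarrow> finite \<K> \<and>
     (\<forall>K\<in>\<K>. compact K \<and> convex K \<and> (\<exists>P. C_k 1 P \<and> (\<forall>x\<in>K. v x = P x)))"

text \<open>
  Only points joined by a segment inside \<open>S\<close> are compared, because \<open>\<Omega>\<close> need not be convex and \<open>v\<close> need
  not be Lipschitz across a gap of \<open>S\<close>.
\<close>

definition line_lipschitz :: "real \<Rightarrow> 'a::euclidean_space set \<Rightarrow> 'a \<Rightarrow> ('a \<Rightarrow> real) \<Rightarrow> bool" where
  "line_lipschitz L S e v \<longleftrightarrow> 0 \<le> L \<and>
     (\<forall>x s. 0 \<le> s \<longrightarrow> (\<forall>t\<in>{0..s}. x + t *\<^sub>R e \<in> S) \<longrightarrow> \<bar>v (x + s *\<^sub>R e) - v x\<bar> \<le> L * s)"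

lemma line_lipschitzD:
  assumes "line_lipschitz L S e v" "0 \<le> s" "\<And>t. t \<in> {0..s} \<Longrightarrow> x + t *\<^sub>R e \<in> S"
  shows "\<bar>v (x + s *\<^sub>R e) - v x\<bar> \<le> L * s"
  using assms by (simp add: line_lipschitz_def)

lemma line_lipschitz_nonneg: "line_lipschitz L S e v \<Longrightarrow> 0 \<le> L"
  by (simp add: line_lipschitz_def)

lemma line_lipschitz_subset: "line_lipschitz L S e v \<Longrightarrow> U \<subseteq> S \<Longrightarrow> line_lipschitz L U e v"
  unfolding line_lipschitz_def by blast

text \<open>
  A segment meets each closed cell in a closed set on which \<open>v\<close> is Lipschitz, and finitely many closed
  sets covering an interval propagate a common Lipschitz constant to the whole interval.
\<close>

lemma piecewise_C1_line_lipschitz: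
  assumes v: "piecewise_C1 \<K> v" and e: "e \<in> Basis"
  obtains L where "line_lipschitz L (\<Union>\<K>) e v"
proof -
  have "\<forall>K\<in>\<K>. \<exists>L. 0 \<le> L \<and> (\<forall>x. L-lipschitz_on {t. x + t *\<^sub>R e \<in> K} (\<lambda>t. v (x + t *\<^sub>R e)))"
  proof
    fix K assume "K \<in> \<K>"
    then obtain P where P: "C_k 1 P" "compact K" "convex K" "\<And>x. x \<in> K \<Longrightarrow> v x = P x"
      using v by (auto simp: piecewise_C1_def)
    obtain L where L: "0 \<le> L" "\<And>x. L-lipschitz_on {t. x + t *\<^sub>R e \<in> K} (\<lambda>t. P (x + t *\<^sub>R e))"
      using C1_line_lipschitz[OF P(1-3) e] by blast
    have "L-lipschitz_on {t. x + t *\<^sub>R e \<in> K} (\<lambda>t. v (x + t *\<^sub>R e))" for x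
      using L(2)[of x] P(4) by (simp add: lipschitz_on_def)
    with L(1) show "\<exists>L. 0 \<le> L \<and> (\<forall>x. L-lipschitz_on {t. x + t *\<^sub>R e \<in> K} (\<lambda>t. v (x + t *\<^sub>R e)))"
      by blast
  qed
  then obtain L where L: "\<And>K. K \<in> \<K> \<Longrightarrow> 0 \<le> L K"
    "\<And>K x. K \<in> \<K> \<Longrightarrow> (L K)-lipschitz_on {t. x + t *\<^sub>R e \<in> K} (\<lambda>t. v (x + t *\<^sub>R e))"
    by metis
  have fin: "finite \<K>" using v by (simp add: piecewise_C1_def)
  have nn: "0 \<le> sum L \<K>" using L(1) by (rule sum_nonneg)
  show thesis
  proof (rule that[of "sum L \<K>"], unfold line_lipschitz_def, intro conjI allI impI nn)
    fix x s assume s: "0 \<le> s" "\<forall>t\<in>{0..s}. x + t *\<^sub>R e \<in> \<Union>\<K>"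
    have "(sum L \<K>)-lipschitz_on {0..s} (\<lambda>t. v (x + t *\<^sub>R e))"
    proof (rule lipschitz_on_closed_Union[where U="\<lambda>K. {t. x + t *\<^sub>R e \<in> K}" and I=\<K>])
      fix K assume K: "K \<in> \<K>"
      show "(sum L \<K>)-lipschitz_on {t. x + t *\<^sub>R e \<in> K} (\<lambda>t. v (x + t *\<^sub>R e))"
        using L(2)[OF K] by (rule lipschitz_on_le) (use fin L(1) K in \<open>auto intro: member_le_sum\<close>)
      have "closed K" using v K by (auto simp: piecewise_C1_def compact_imp_closed)
      then have "closed ((\<lambda>t. x + t *\<^sub>R e) -` K)"
        by (rule continuous_closed_vimage) (auto intro!: continuous_intros)
      then show "closed {t. x + t *\<^sub>R e \<in> K}" by (simp add: vimage_def)
    qed (use fin nn s(2) in auto)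
    from lipschitz_onD[OF this, of s 0] s(1) show "\<bar>v (x + s *\<^sub>R e) - v x\<bar> \<le> sum L \<K> * s"
      by (simp add: dist_real_def)
  qed
qed

lemma L2_I_bounded:
  fixes f :: "'a::euclidean_space \<Rightarrow> 'b::euclidean_space"
  assumes \<Omega>: "open \<Omega>" "bounded \<Omega>" and f: "set_borel_measurable lebesgue \<Omega> f"
    and bnd: "AE x in lebesgue. x \<in> \<Omega> \<longrightarrow> norm (f x) \<le> B"
  shows "f \<in> L2 \<Omega>"
proof -
  have fin: "emeasure lebesgue \<Omega> < \<infinity>"
    using \<Omega> emeasure_bounded_finite[OF \<Omega>(2)] by simp
  have "(\<lambda>x. (norm (indicator \<Omega> x *\<^sub>R f x))\<^sup>2) \<in> borel_measurable lebesgue"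
    using measurable_compose[OF f[unfolded set_borel_measurable_def] borel_measurable_norm]
    by (rule borel_measurable_power)
  moreover have "(\<lambda>x. indicator \<Omega> x *\<^sub>R (norm (f x))\<^sup>2) = (\<lambda>x. (norm (indicator \<Omega> x *\<^sub>R f x))\<^sup>2)"
    by (auto simp: fun_eq_iff indicator_def)
  ultimately have m: "(\<lambda>x. indicator \<Omega> x *\<^sub>R (norm (f x))\<^sup>2) \<in> borel_measurable lebesgue"
    by simp
  have "integrable lebesgue (\<lambda>x. indicator \<Omega> x *\<^sub>R (norm (f x))\<^sup>2)"
  proof (rule integrableI_bounded_set[where A=\<Omega> and B="B\<^sup>2", OF _ m fin])
    show "AE x in lebesgue. x \<in> \<Omega> \<longrightarrow> norm (indicator \<Omega> x *\<^sub>R (norm (f x))\<^sup>2) \<le> B\<^sup>2"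
      using bnd by eventually_elim (auto simp: power_mono)
  qed (use \<Omega> in auto)
  with f show ?thesis by (simp add: L2_def set_integrable_def)
qed

lemma lborel_integral_translate:
  fixes f :: "'a::euclidean_space \<Rightarrow> real"
  assumes [measurable]: "f \<in> borel_measurable borel"
  shows "(LINT x|lborel. f (x + a)) = (LINT x|lborel. f x)"
proof -
  have "(LINT x|lborel. f x) = (LINT x|distr lborel borel ((+) a). f x)"
    by (simp add: lborel_distr_plus)
  also have "\<dots> = (LINT x|lborel. f (a + x))"
    by (rule integral_distr) auto
  finally show ?thesis by (simp add: add.commute)
qed

lemma lborel_integrable_bounded_support:
  fixes f :: "'a::euclidean_space \<Rightarrow> real"
  assumes "f \<in> borel_measurable borel" "bounded S" "\<And>x. \<bar>f x\<bar> \<le> B" "\<And>x. x \<notin> S \<Longrightarrow> f x = 0"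
  shows "integrable lborel f"
proof (rule integrableI_bounded_set[where A="closure S" and B=B])
  show "emeasure lborel (closure S) < \<infinity>"
    using assms(2) by (intro emeasure_bounded_finite) (simp add: bounded_closure)
  show "AE x in lborel. x \<notin> closure S \<longrightarrow> f x = 0"
    using assms(4) closure_subset[of S] by auto
qed (use assms in auto)

lemma test_functionD:
  assumes "\<theta> \<in> test_functions \<Omega>"
  shows "C_k k \<theta>" "compact (closure {x. \<theta> x \<noteq> 0})" "closure {x. \<theta> x \<noteq> 0} \<subseteq> \<Omega>"
    "x \<notin> \<Omega> \<Longrightarrow> \<theta> x = 0"
  using assms closure_subset[of "{x. \<theta> x \<noteq> 0}"] by (auto simp: test_functions_def)

lemma test_function_bounded:
  assumes "\<theta> \<in> test_functions \<Omega>"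
  obtains B where "\<And>x. \<bar>\<theta> x\<bar> \<le> B"
proof -
  have "bounded (\<theta> ` closure {x. \<theta> x \<noteq> 0})"
    by (intro compact_imp_bounded compact_continuous_image C_k_continuous_on[of 0]
        test_functionD[OF assms])
  then obtain B where B: "\<forall>y\<in>\<theta> ` closure {x. \<theta> x \<noteq> 0}. norm y \<le> B"
    unfolding bounded_iff ..
  show thesis
  proof (rule that[of "max 0 B"])
    fix x show "\<bar>\<theta> x\<bar> \<le> max 0 B"
    proof (cases "\<theta> x = 0")
      case False
      then have "x \<in> closure {x. \<theta> x \<noteq> 0}"
        using closure_subset[of "{x. \<theta> x \<noteq> 0}"] by blast
      then have "norm (\<theta> x) \<le> B" using B by blast
      then show ?thesis by simp
    qed simp
  qed
qed

lemma directional_quotient_tendsto: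
  assumes P: "(P has_derivative P') (at x)" and s: "s \<longlonglongrightarrow> 0" "\<And>n. s n \<noteq> (0::real)"
  shows "(\<lambda>n. (P (x + s n *\<^sub>R e) - P x) / s n) \<longlonglongrightarrow> (P' e :: real)"
proof -
  have 1: "((\<lambda>t. x + t *\<^sub>R e) has_derivative (\<lambda>h. h *\<^sub>R e)) (at 0)"
    by (auto intro!: derivative_eq_intros)
  have "((\<lambda>t. P (x + t *\<^sub>R e)) has_derivative (\<lambda>h. P' (h *\<^sub>R e))) (at 0)"
    using has_derivative_compose[OF 1, of P P'] P by simp
  then have "((\<lambda>t. P (x + t *\<^sub>R e)) has_field_derivative P' e) (at 0)"
    using has_derivative_linear[OF P]
    by (simp add: has_field_derivative_def linear_scale mult.commute[of _ "P' e"])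
  then have "((\<lambda>t. (P (x + t *\<^sub>R e) - P x) / t) \<longlongrightarrow> P' e) (at 0)"
    by (simp add: has_field_derivative_iff)
  then show ?thesis
    by (rule filterlim_compose) (use s in \<open>auto simp: filterlim_at\<close>)
qed

text \<open>
  Let \<open>D n\<close> be the difference quotient of \<open>v\<close>, extended by zero, with step \<open>1 / (n + 1)\<close> along a
  coordinate, and \<open>q n\<close> the backward quotient of a test function \<open>\<theta>\<close>. Translation invariance
  gives \<open>\<integral> D n * \<theta> = \<integral> v * q n\<close>. The right-hand side tends to \<open>- \<integral> v * \<partial>\<theta>\<close>; on the left,
  \<open>D n\<close> is bounded on the support of \<open>\<theta>\<close> for large \<open>n\<close> and converges inside every cell. Taking
  the candidate gradient to be the pointwise limit of the \<open>D n\<close>, rather than gluing the gradients of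
  the pieces, gives its measurability for free.
\<close>

lemma piecewise_C1_in_H1:
  fixes \<Omega> :: "(real ^ 'd) set" and v :: "real ^ 'd \<Rightarrow> real"
  assumes \<Omega>: "open \<Omega>" "\<Omega> \<subseteq> \<Union>\<K>" and v: "piecewise_C1 \<K> v" and cont: "continuous_on \<Omega> v"
  shows "v \<in> H1 \<Omega>" and "bounded (v ` \<Omega>)"
proof -
  have fin: "finite \<K>" and cell: "\<And>K. K \<in> \<K> \<Longrightarrow> compact K \<and> convex K"
    using v by (auto simp: piecewise_C1_def)
  have bd: "bounded \<Omega>"
    using \<Omega>(2) fin cell by (meson bounded_Union bounded_subset compact_imp_bounded)
  have "\<forall>K\<in>\<K>. \<exists>B. \<forall>x\<in>K. \<bar>v x\<bar> \<le> B"
  proof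
    fix K assume "K \<in> \<K>"
    then obtain P where P: "C_k 1 P" "compact K" "\<And>x. x \<in> K \<Longrightarrow> v x = P x"
      using v by (auto simp: piecewise_C1_def)
    have "bounded (P ` K)"
      using P by (intro compact_imp_bounded compact_continuous_image C_k_continuous_on[of 1])
    then show "\<exists>B. \<forall>x\<in>K. \<bar>v x\<bar> \<le> B"
      using P(3) by (auto simp: bounded_iff)
  qed
  then obtain BK where BK: "\<And>K x. K \<in> \<K> \<Longrightarrow> x \<in> K \<Longrightarrow> \<bar>v x\<bar> \<le> BK K"
    by metis
  define B where "B = (\<Sum>K\<in>\<K>. \<bar>BK K\<bar>)"
  have B0: "0 \<le> B" by (simp add: B_def sum_nonneg)
  have B: "\<bar>v x\<bar> \<le> B" if x: "x \<in> \<Omega>" for x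
  proof -
    obtain K where K: "K \<in> \<K>" "x \<in> K" using x \<Omega>(2) by auto
    have "\<bar>v x\<bar> \<le> \<bar>BK K\<bar>" using BK[OF K] by simp
    also have "\<dots> \<le> B" unfolding B_def using fin K(1) by (intro member_le_sum) auto
    finally show ?thesis .
  qed
  define v0 where "v0 x = indicator \<Omega> x * v x" for x
  have v0m[measurable]: "v0 \<in> borel_measurable borel"
    using borel_measurable_continuous_on_indicator[OF _ cont] \<Omega>(1) by (simp add: v0_def[abs_def])
  have v0B: "\<bar>v0 x\<bar> \<le> B" for x
    using B[of x] B0 by (auto simp: v0_def indicator_def)
  have v0in: "v0 x = v x" if "x \<in> \<Omega>" for x using that by (simp add: v0_def)
  have v0out: "v0 x = 0" if "x \<notin> \<Omega>" for x using that by (simp add: v0_def)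
  define s where "s n = 1 / real (Suc n)" for n
  have s: "0 < s n" "s n \<noteq> 0" for n by (auto simp: s_def)
  have s0: "s \<longlonglongrightarrow> 0" unfolding s_def by real_asymp
  define e where "e i = (axis i 1 :: real ^ 'd)" for i
  have eB: "e i \<in> Basis" for i by (simp add: e_def axis_in_Basis_iff)
  have ne: "norm (e i) = 1" for i using eB by simp
  define D where "D i n x = (v0 (x + s n *\<^sub>R e i) - v0 x) / s n" for i n x
  define G where "G i x = lim (\<lambda>n. D i n x)" for i x
  have Dm[measurable]: "D i n \<in> borel_measurable borel" for i n
    unfolding D_def[abs_def] by measurable
  have Gm[measurable]: "G i \<in> borel_measurable borel" for i
    unfolding G_def[abs_def] by (rule borel_measurable_lim_metric) simp
  have "\<exists>L. line_lipschitz L \<Omega> (e i) v" for i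
  proof -
    obtain L where "line_lipschitz L (\<Union>\<K>) (e i) v"
      by (rule piecewise_C1_line_lipschitz[OF v eB[of i]])
    from line_lipschitz_subset[OF this \<Omega>(2)] show ?thesis ..
  qed
  then obtain L where L: "\<And>i. line_lipschitz (L i) \<Omega> (e i) v"
    by metis
  note L0 = line_lipschitz_nonneg[OF L]
  \<comment> \<open>The extension by zero may jump across the boundary of \<open>\<Omega>\<close>, so the bound on the quotients
      holds only for steps smaller than the distance to it.\<close>
  have DL: "\<bar>D i n x\<bar> \<le> L i" if "ball x r \<subseteq> \<Omega>" "s n < r" for i n x r
  proof -
    have inb: "x + t *\<^sub>R e i \<in> \<Omega>" if "t \<in> {0..s n}" for t
    proof -
      have "x + t *\<^sub>R e i \<in> ball x r"
        using that \<open>s n < r\<close> ne[of i] by (simp add: dist_norm)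
      with \<open>ball x r \<subseteq> \<Omega>\<close> show ?thesis by blast
    qed
    have "\<bar>v (x + s n *\<^sub>R e i) - v x\<bar> \<le> L i * s n"
      using s(1)[of n] inb by (intro line_lipschitzD[OF L]) auto
    moreover have "x \<in> \<Omega>" "x + s n *\<^sub>R e i \<in> \<Omega>"
      using inb[of 0] inb[of "s n"] s(1)[of n] by auto
    ultimately show ?thesis
      using s(1)[of n] by (simp add: D_def v0in divide_le_eq)
  qed
  have conv: "(\<lambda>n. D i n x) \<longlonglongrightarrow> G i x \<and> \<bar>G i x\<bar> \<le> L i" if x: "x \<in> \<Omega>" "K \<in> \<K>" "x \<in> interior K" for i x K
  proof -
    obtain P where P: "C_k 1 P" "\<And>x. x \<in> K \<Longrightarrow> v x = P x"
      using v x(2) by (auto simp: piecewise_C1_def)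
    have der: "(P has_derivative frechet_derivative P (at x)) (at x)"
      using P(1) by (intro C_k_Suc_has_derivative[of 0]) simp
    let ?d = "frechet_derivative P (at x) (e i)"
    have "open (\<Omega> \<inter> interior K)" using \<Omega>(1) by auto
    then obtain r where r: "0 < r" "ball x r \<subseteq> \<Omega> \<inter> interior K"
      using x by (meson IntI openE)
    have small: "\<forall>\<^sub>F n in sequentially. s n < r"
      using order_tendstoD(2)[OF s0 r(1)] .
    have "(\<lambda>n. (P (x + s n *\<^sub>R e i) - P x) / s n) \<longlonglongrightarrow> ?d"
      by (rule directional_quotient_tendsto[OF der s0 s(2)])
    then have lim: "(\<lambda>n. D i n x) \<longlonglongrightarrow> ?d"
    proof (rule Lim_transform_eventually)
      show "\<forall>\<^sub>F n in sequentially. (P (x + s n *\<^sub>R e i) - P x) / s n = D i n x"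
        using small
      proof eventually_elim
        case (elim n)
        have "x + s n *\<^sub>R e i \<in> ball x r" using elim ne s(1)[of n] by (simp add: dist_norm)
        then have "x + s n *\<^sub>R e i \<in> \<Omega>" "x + s n *\<^sub>R e i \<in> K" "x \<in> K"
          using r(2) x(3) interior_subset[of K] by (auto dest: subsetD)
        then show ?case using x by (simp add: D_def v0in P(2))
      qed
    qed
    then have "G i x = ?d" by (simp add: G_def limI)
    moreover have "\<bar>?d\<bar> \<le> L i"
    proof (rule tendsto_upperbound[OF tendsto_rabs[OF lim]])
      show "\<forall>\<^sub>F n in sequentially. \<bar>D i n x\<bar> \<le> L i"
        using small by eventually_elim (use DL[of x r] r(2) in simp)
    qed simp
    ultimately show ?thesis using lim by simp
  qed
  have null: "(\<Union>K\<in>\<K>. frontier K) \<in> null_sets lebesgue"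
  proof (rule null_sets.finite_UN[OF fin])
    fix K assume "K \<in> \<K>"
    then have "negligible (frontier K)" using cell negligible_convex_frontier by blast
    then show "frontier K \<in> null_sets lebesgue" by (simp add: negligible_iff_null_sets)
  qed
  have ae: "AE x in lebesgue. x \<in> \<Omega> \<longrightarrow> (\<exists>K\<in>\<K>. x \<in> interior K)"
  proof (rule AE_I'[OF null], clarsimp)
    fix x assume x: "x \<in> \<Omega>" "\<forall>K\<in>\<K>. x \<notin> interior K"
    then obtain K where K: "K \<in> \<K>" "x \<in> K" using \<Omega>(2) by auto
    have "x \<in> frontier K"
      using K x(2) closure_subset[of K] by (auto simp: frontier_def)
    with K(1) show "\<exists>K\<in>\<K>. x \<in> frontier K" ..
  qed
  define g where "g x = (\<chi> i. G i x)" for x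
  have "g \<in> borel_measurable borel"
  proof (rule borel_measurable_euclidean_space[THEN iffD2], rule ballI)
    fix b :: "real ^ 'd" assume "b \<in> Basis"
    then obtain i where b: "b = axis i 1" by (auto simp: Basis_vec_def)
    show "(\<lambda>x. g x \<bullet> b) \<in> borel_measurable borel"
      by (simp add: b inner_axis g_def)
  qed
  then have gm: "set_borel_measurable lebesgue \<Omega> g"
    unfolding set_borel_measurable_def using \<Omega>(1)
    by (intro borel_imp_lebesgue borel_measurable_scaleR) auto
  have gL2: "g \<in> L2 \<Omega>"
  proof (rule L2_I_bounded[OF \<Omega>(1) bd gm])
    show "AE x in lebesgue. x \<in> \<Omega> \<longrightarrow> norm (g x) \<le> (\<Sum>i\<in>UNIV. L i)"
      using ae
    proof eventually_elim
      case (elim x)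
      show ?case
      proof
        assume "x \<in> \<Omega>"
        with elim obtain K where "x \<in> \<Omega>" "K \<in> \<K>" "x \<in> interior K" by blast
        from conv[OF this] have "\<bar>G i x\<bar> \<le> L i" for i by simp
        then have "(\<Sum>i\<in>UNIV. \<bar>g x $ i\<bar>) \<le> (\<Sum>i\<in>UNIV. L i)" by (auto simp: g_def intro: sum_mono)
        with norm_le_l1_cart[of "g x"] show "norm (g x) \<le> (\<Sum>i\<in>UNIV. L i)" by linarith
      qed
    qed
  qed
  have vL2: "v \<in> L2 \<Omega>"
  proof (rule L2_I_bounded[OF \<Omega>(1) bd])
    show "set_borel_measurable lebesgue \<Omega> v"
      using borel_imp_lebesgue[OF v0m] by (simp add: set_borel_measurable_def v0_def[abs_def])
  qed (use B in auto)
  have "has_weak_grad \<Omega> v g"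
    unfolding has_weak_grad_def
  proof (intro ballI allI)
    fix \<theta> i assume \<theta>: "\<theta> \<in> test_functions \<Omega>"
    note \<theta>D = test_functionD[OF \<theta>]
    have \<theta>m[measurable]: "\<theta> \<in> borel_measurable borel" using \<theta> by (rule test_functions_borel)
    let ?d = "\<lambda>x. frechet_derivative \<theta> (at x) (e i)"
    have "continuous_on UNIV ?d"
      using \<theta>D(1)[of 1] eB by simp
    then have dm[measurable]: "?d \<in> borel_measurable borel"
      by (rule borel_measurable_continuous_onI)
    obtain T where T: "\<And>x. \<bar>\<theta> x\<bar> \<le> T" using test_function_bounded[OF \<theta>] by blast
    have T0: "0 \<le> T" using T[of 0] by linarith
    define q where "q n y = (\<theta> (y - s n *\<^sub>R e i) - \<theta> y) / s n" for n y
    have qm[measurable]: "q n \<in> borel_measurable borel" for n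
      unfolding q_def[abs_def] by measurable
    have int1: "integrable lborel (\<lambda>x. v0 x * \<theta> (x - a))" for a
    proof (rule lborel_integrable_bounded_support[OF _ bd])
      show "\<bar>v0 x * \<theta> (x - a)\<bar> \<le> B * T" for x
        unfolding abs_mult using v0B T B0 by (intro mult_mono) auto
    qed (auto simp: v0out)
    have int2: "integrable lborel (\<lambda>x. v0 (x + a) * \<theta> x)" for a
    proof (rule lborel_integrable_bounded_support[OF _ bd])
      show "\<bar>v0 (x + a) * \<theta> x\<bar> \<le> B * T" for x
        unfolding abs_mult using v0B T B0 by (intro mult_mono) auto
    qed (auto simp: \<theta>D)
    have parts: "(LINT x|lborel. D i n x * \<theta> x) = (LINT y|lborel. v0 y * q n y)" for n
    proof -
      have "(LINT x|lborel. D i n x * \<theta> x)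
          = (LINT x|lborel. (v0 (x + s n *\<^sub>R e i) * \<theta> x - v0 x * \<theta> x) / s n)"
        by (simp add: D_def algebra_simps diff_divide_distrib)
      also have "\<dots> = ((LINT x|lborel. v0 (x + s n *\<^sub>R e i) * \<theta> x) - (LINT x|lborel. v0 x * \<theta> x)) / s n"
        using int2[of "s n *\<^sub>R e i"] int2[of 0] by simp
      also have "(LINT x|lborel. v0 (x + s n *\<^sub>R e i) * \<theta> x)
          = (LINT y|lborel. v0 y * \<theta> (y - s n *\<^sub>R e i))"
        using lborel_integral_translate[of "\<lambda>y. v0 y * \<theta> (y - s n *\<^sub>R e i)" "s n *\<^sub>R e i"] by simp
      also have "((LINT y|lborel. v0 y * \<theta> (y - s n *\<^sub>R e i)) - (LINT x|lborel. v0 x * \<theta> x)) / s n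
          = (LINT y|lborel. (v0 y * \<theta> (y - s n *\<^sub>R e i) - v0 y * \<theta> y) / s n)"
        using int1[of "s n *\<^sub>R e i"] int1[of 0] by simp
      also have "\<dots> = (LINT y|lborel. v0 y * q n y)"
        by (simp add: q_def algebra_simps diff_divide_distrib)
      finally show ?thesis .
    qed
    obtain R where R: "\<Omega> \<subseteq> cball 0 R" using bounded_subset_ballD[OF bd] ball_subset_cball by (meson order_trans)
    \<comment> \<open>Backward steps from \<open>\<Omega>\<close> have length at most \<open>1\<close>, so the ball of radius \<open>R + 1\<close> contains
        all segments that occur in \<open>q n\<close>.\<close>
    have pwe: "piecewise_C1 {cball 0 (R + 1)} \<theta>"
      using \<theta>D(1)[of 1] by (auto simp: piecewise_C1_def)
    obtain L' where L': "line_lipschitz L' (\<Union>{cball 0 (R + 1)}) (e i) \<theta>"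
      using piecewise_C1_line_lipschitz[OF pwe eB[of i]] by blast
    have qL: "\<bar>q n y\<bar> \<le> L'" if y: "y \<in> \<Omega>" for n y
    proof -
      have "s n \<le> 1" by (simp add: s_def)
      have "\<bar>\<theta> ((y - s n *\<^sub>R e i) + s n *\<^sub>R e i) - \<theta> (y - s n *\<^sub>R e i)\<bar> \<le> L' * s n"
      proof (rule line_lipschitzD[OF L'])
        fix t assume t: "t \<in> {0..s n}"
        have "norm (y - s n *\<^sub>R e i + t *\<^sub>R e i) \<le> norm y + norm ((t - s n) *\<^sub>R e i)"
          by (metis add_diff_eq diff_add_eq norm_triangle_ineq scaleR_diff_left)
        also have "norm ((t - s n) *\<^sub>R e i) \<le> 1"
          using t \<open>s n \<le> 1\<close> ne by simp
        also have "norm y \<le> R" using y R by auto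
        finally show "y - s n *\<^sub>R e i + t *\<^sub>R e i \<in> \<Union>{cball 0 (R + 1)}" by simp
      qed (use s(1)[of n] in simp)
      then show ?thesis
        using s(1)[of n] by (simp add: q_def divide_le_eq abs_minus_commute)
    qed
    have lim1: "(\<lambda>n. LINT y|lborel. v0 y * q n y) \<longlonglongrightarrow> (LINT y|lborel. v0 y * - ?d y)"
    proof (rule integral_dominated_convergence[where w="\<lambda>y. indicator \<Omega> y * (B * L')"])
      have "(\<lambda>n. q n y) \<longlonglongrightarrow> - ?d y" for y
      proof -
        have der: "(\<theta> has_derivative frechet_derivative \<theta> (at y)) (at y)"
          by (rule C_k_Suc_has_derivative[OF \<theta>D(1)])
        have ms: "(\<lambda>n. - s n) \<longlonglongrightarrow> 0" using tendsto_minus[OF s0] by simp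
        have "(\<lambda>n. - ((\<theta> (y + (- s n) *\<^sub>R e i) - \<theta> y) / - s n)) \<longlonglongrightarrow> - ?d y"
          by (intro tendsto_minus directional_quotient_tendsto[OF der ms]) (use s in auto)
        then show ?thesis by (simp add: q_def)
      qed
      then show "AE y in lborel. (\<lambda>n. v0 y * q n y) \<longlonglongrightarrow> v0 y * - ?d y"
        by (intro AE_I2 tendsto_mult tendsto_const)
      show "integrable lborel (\<lambda>y. indicator \<Omega> y * (B * L'))"
      proof (rule lborel_integrable_bounded_support[OF _ bd])
        show "(\<lambda>y. indicator \<Omega> y * (B * L')) \<in> borel_measurable borel"
          using \<Omega>(1) by (intro borel_measurable_times) auto
        show "\<bar>indicator \<Omega> y * (B * L')\<bar> \<le> B * L'" for y
          using B0 line_lipschitz_nonneg[OF L'] by (auto simp: indicator_def)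
      qed auto
      show "AE y in lborel. norm (v0 y * q n y) \<le> indicator \<Omega> y * (B * L')" for n
      proof (rule AE_I2)
        fix y show "norm (v0 y * q n y) \<le> indicator \<Omega> y * (B * L')"
          using v0B[of y] qL[of y n] v0out[of y] B0
          by (cases "y \<in> \<Omega>") (auto simp: abs_mult intro!: mult_mono)
      qed
    qed auto
    obtain \<rho> where \<rho>: "0 < \<rho>" "(\<Union>x\<in>closure {x. \<theta> x \<noteq> 0}. ball x \<rho>) \<subseteq> \<Omega>"
      using compact_subset_open_imp_ball_epsilon_subset[OF \<theta>D(2) \<Omega>(1) \<theta>D(3)] by blast
    obtain N where N: "\<And>n. N \<le> n \<Longrightarrow> s n < \<rho>"
      using order_tendstoD(2)[OF s0 \<rho>(1)] by (auto simp: eventually_sequentially)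
    have aeb: "AE x in lborel. x \<in> \<Omega> \<longrightarrow> (\<exists>K\<in>\<K>. x \<in> interior K)"
      using ae by (simp add: AE_completion_iff)
    \<comment> \<open>From index \<open>N\<close> on, the step is smaller than the distance \<open>\<rho>\<close> of the support of \<open>\<theta>\<close> to the
        boundary, which makes the integrands uniformly bounded.\<close>
    have lim2: "(\<lambda>n. LINT x|lborel. D i (n + N) x * \<theta> x) \<longlonglongrightarrow> (LINT x|lborel. G i x * \<theta> x)"
    proof (rule integral_dominated_convergence[where w="\<lambda>x. L i * \<bar>\<theta> x\<bar>"])
      show "integrable lborel (\<lambda>x. L i * \<bar>\<theta> x\<bar>)"
      proof (rule lborel_integrable_bounded_support[OF _ bd])
        show "\<bar>L i * \<bar>\<theta> x\<bar>\<bar> \<le> L i * T" for x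
          using L0[of i] T by (auto simp: abs_mult intro!: mult_left_mono)
      qed (auto simp: \<theta>D)
      show "AE x in lborel. (\<lambda>n. D i (n + N) x * \<theta> x) \<longlonglongrightarrow> G i x * \<theta> x"
        using aeb
      proof eventually_elim
        case (elim x)
        show ?case
        proof (cases "x \<in> \<Omega>")
          case True
          with elim obtain K where "x \<in> \<Omega>" "K \<in> \<K>" "x \<in> interior K" by blast
          from conv[OF this] have "(\<lambda>n. D i n x) \<longlonglongrightarrow> G i x" by simp
          then have "(\<lambda>n. D i (n + N) x) \<longlonglongrightarrow> G i x" by (rule LIMSEQ_ignore_initial_segment)
          then show ?thesis by (intro tendsto_mult) auto
        qed (simp add: \<theta>D)
      qed
      show "AE x in lborel. norm (D i (n + N) x * \<theta> x) \<le> L i * \<bar>\<theta> x\<bar>" for n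
      proof (rule AE_I2)
        fix x show "norm (D i (n + N) x * \<theta> x) \<le> L i * \<bar>\<theta> x\<bar>"
        proof (cases "\<theta> x = 0")
          case False
          then have "x \<in> closure {x. \<theta> x \<noteq> 0}" using closure_subset[of "{x. \<theta> x \<noteq> 0}"] by blast
          then have "ball x \<rho> \<subseteq> \<Omega>" using \<rho>(2) by blast
          then have "\<bar>D i (n + N) x\<bar> \<le> L i" using N[of "n + N"] by (intro DL) auto
          then show ?thesis by (auto simp: abs_mult intro!: mult_right_mono)
        qed simp
      qed
    qed auto
    have "(\<lambda>n. LINT x|lborel. D i (n + N) x * \<theta> x) \<longlonglongrightarrow> (LINT y|lborel. v0 y * - ?d y)"
      unfolding parts by (rule LIMSEQ_ignore_initial_segment[OF lim1])
    from LIMSEQ_unique[OF this lim2]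
    have eq: "(LINT y|lborel. v0 y * ?d y) = - (LINT x|lborel. G i x * \<theta> x)"
      by (simp add: minus_equation_iff)
    have "(LINT x|lborel. v0 x * ?d x) = (LINT x|lebesgue. v0 x * ?d x)"
      by (rule integral_completion[symmetric]) simp
    then have l: "(LINT x:\<Omega>|lebesgue. v x * ?d x) = (LINT x|lborel. v0 x * ?d x)"
      by (simp add: set_lebesgue_integral_def v0_def mult.assoc)
    have "(LINT x|lborel. G i x * \<theta> x) = (LINT x|lebesgue. G i x * \<theta> x)"
      by (rule integral_completion[symmetric]) simp
    moreover have "indicator \<Omega> x *\<^sub>R (g x $ i * \<theta> x) = G i x * \<theta> x" for x
      using \<theta>D(4)[of x] by (cases "x \<in> \<Omega>") (auto simp: g_def)
    ultimately have r: "(LINT x:\<Omega>|lebesgue. g x $ i * \<theta> x) = (LINT x|lborel. G i x * \<theta> x)"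
      by (simp only: set_lebesgue_integral_def)
    show "(LINT x:\<Omega>|lebesgue. v x * frechet_derivative \<theta> (at x) (axis i 1)) =
        - (LINT x:\<Omega>|lebesgue. g x $ i * \<theta> x)"
      using eq l r by (simp add: e_def)
  qed
  then show "v \<in> H1 \<Omega>" using vL2 gL2 by (auto simp: H1_def)
  show "bounded (v ` \<Omega>)" using B by (auto simp: bounded_iff)
qed

section \<open>Square integrable functions\<close>

lemma L2_set_integrable_inner:
  fixes f g :: "'a::euclidean_space \<Rightarrow> 'b::euclidean_space"
  assumes f: "f \<in> L2 \<Omega>" and g: "g \<in> L2 \<Omega>"
  shows "set_integrable lebesgue \<Omega> (\<lambda>x. f x \<bullet> g x)"
proof (rule set_integrable_bound)
  show "set_integrable lebesgue \<Omega> (\<lambda>x. (norm (f x))\<^sup>2 + (norm (g x))\<^sup>2)"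
    using f g by (intro set_integral_add) (auto simp: L2_def)
  have "(\<lambda>x. (indicator \<Omega> x *\<^sub>R f x) \<bullet> (indicator \<Omega> x *\<^sub>R g x)) \<in> borel_measurable lebesgue"
    using f g by (intro borel_measurable_inner) (auto simp: L2_def set_borel_measurable_def)
  moreover have "(\<lambda>x. (indicator \<Omega> x *\<^sub>R f x) \<bullet> (indicator \<Omega> x *\<^sub>R g x))
      = (\<lambda>x. indicator \<Omega> x *\<^sub>R (f x \<bullet> g x))"
    by (auto simp: fun_eq_iff indicator_def)
  ultimately show "set_borel_measurable lebesgue \<Omega> (\<lambda>x. f x \<bullet> g x)"
    by (simp add: set_borel_measurable_def)
  show "AE x in lebesgue. x \<in> \<Omega> \<longrightarrow> norm (f x \<bullet> g x) \<le> norm ((norm (f x))\<^sup>2 + (norm (g x))\<^sup>2)"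
  proof (intro AE_I2 impI)
    fix x
    have "\<bar>f x \<bullet> g x\<bar> \<le> norm (f x) * norm (g x)" by (rule Cauchy_Schwarz_ineq2)
    also have "\<dots> \<le> (norm (f x))\<^sup>2 + (norm (g x))\<^sup>2"
    proof -
      have "0 \<le> norm (f x) * norm (g x)" by simp
      with sum_squares_bound[of "norm (f x)" "norm (g x)"] show ?thesis
        unfolding mult.assoc by linarith
    qed
    finally show "norm (f x \<bullet> g x) \<le> norm ((norm (f x))\<^sup>2 + (norm (g x))\<^sup>2)" by simp
  qed
qed

lemma L2_lincomb:
  fixes f g :: "'a::euclidean_space \<Rightarrow> 'b::euclidean_space"
  assumes f: "f \<in> L2 \<Omega>" and g: "g \<in> L2 \<Omega>"
  shows "(\<lambda>x. a *\<^sub>R f x + b *\<^sub>R g x) \<in> L2 \<Omega>"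
proof -
  have "(\<lambda>x. a *\<^sub>R (indicator \<Omega> x *\<^sub>R f x) + b *\<^sub>R (indicator \<Omega> x *\<^sub>R g x)) \<in> borel_measurable lebesgue"
    using f g unfolding L2_def set_borel_measurable_def
    by (intro borel_measurable_add borel_measurable_scaleR[OF borel_measurable_const]) auto
  then have "set_borel_measurable lebesgue \<Omega> (\<lambda>x. a *\<^sub>R f x + b *\<^sub>R g x)"
    by (simp add: set_borel_measurable_def scaleR_add_right mult.commute)
  moreover have "set_integrable lebesgue \<Omega> (\<lambda>x. (norm (a *\<^sub>R f x + b *\<^sub>R g x))\<^sup>2)"
  proof -
    have eq: "(norm (a *\<^sub>R f x + b *\<^sub>R g x))\<^sup>2
        = a\<^sup>2 * (f x \<bullet> f x) + (2 * a * b) * (f x \<bullet> g x) + b\<^sup>2 * (g x \<bullet> g x)" for x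
      unfolding power2_norm_eq_inner
      by (simp add: inner_add_left inner_add_right inner_commute[of "g x" "f x"]
          power2_eq_square algebra_simps)
    show ?thesis
      unfolding eq
      by (intro set_integral_add set_integrable_mult_right L2_set_integrable_inner f g)
  qed
  ultimately show ?thesis by (simp add: L2_def)
qed

lemma L2_component: "(g :: 'a::euclidean_space \<Rightarrow> real ^ 'd) \<in> L2 \<Omega> \<Longrightarrow> (\<lambda>x. g x $ i) \<in> L2 \<Omega>"
proof -
  assume g: "g \<in> L2 \<Omega>"
  have nth: "(\<lambda>y. y $ i) \<in> borel_measurable (borel :: (real ^ 'd) measure)"
    by (intro borel_measurable_continuous_onI continuous_intros)
  have "(\<lambda>x. (indicator \<Omega> x *\<^sub>R g x) $ i) \<in> borel_measurable lebesgue"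
    using g by (intro measurable_compose[OF _ nth]) (auto simp: L2_def set_borel_measurable_def)
  then have m: "(\<lambda>x. indicator \<Omega> x * (g x $ i)) \<in> borel_measurable lebesgue" by simp
  have "(\<lambda>x. (indicator \<Omega> x * (g x $ i))\<^sup>2) \<in> borel_measurable lebesgue"
    using m by (rule borel_measurable_power)
  moreover have "(\<lambda>x. (indicator \<Omega> x * (g x $ i))\<^sup>2) = (\<lambda>x. indicator \<Omega> x * (g x $ i)\<^sup>2)"
    by (auto simp: fun_eq_iff indicator_def)
  ultimately have "set_borel_measurable lebesgue \<Omega> (\<lambda>x. (norm (g x $ i))\<^sup>2)"
    by (simp add: set_borel_measurable_def)
  then have "set_integrable lebesgue \<Omega> (\<lambda>x. (norm (g x $ i))\<^sup>2)"
  proof (rule set_integrable_bound[rotated])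
    show "set_integrable lebesgue \<Omega> (\<lambda>x. (norm (g x))\<^sup>2)" using g by (simp add: L2_def)
    have "norm ((norm (g x $ i))\<^sup>2) \<le> norm ((norm (g x))\<^sup>2)" for x
      using power_mono[OF component_le_norm_cart[of "g x" i], of 2] by simp
    then show "AE x in lebesgue. x \<in> \<Omega> \<longrightarrow> norm ((norm (g x $ i))\<^sup>2) \<le> norm ((norm (g x))\<^sup>2)"
      by simp
  qed
  with m show ?thesis by (simp add: L2_def set_borel_measurable_def)
qed

lemma continuous_bounded_in_L2:
  fixes f :: "'a::euclidean_space \<Rightarrow> 'b::euclidean_space"
  assumes \<Omega>: "open \<Omega>" "bounded \<Omega>" and f: "continuous_on \<Omega> f" "bounded (f ` \<Omega>)"
  shows "f \<in> L2 \<Omega>"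
proof -
  have "(\<lambda>x. indicator \<Omega> x *\<^sub>R f x) \<in> borel_measurable borel"
    using \<Omega> f by (intro borel_measurable_continuous_on_indicator) auto
  then have m: "set_borel_measurable lebesgue \<Omega> f"
    by (simp add: set_borel_measurable_def borel_imp_lebesgue)
  obtain B where "\<forall>y\<in>f ` \<Omega>. norm y \<le> B" using f(2) unfolding bounded_iff ..
  then show ?thesis by (intro L2_I_bounded[OF \<Omega> m, of B]) auto
qed

lemma continuous_in_L2:
  fixes h :: "'a::euclidean_space \<Rightarrow> real"
  assumes \<Omega>: "open \<Omega>" "bounded \<Omega>" and h: "continuous_on UNIV h"
  shows "h \<in> L2 \<Omega>"
proof (rule continuous_bounded_in_L2[OF \<Omega>])
  show "continuous_on \<Omega> h" using h continuous_on_subset by blast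
  have "compact (h ` closure \<Omega>)"
    using h \<Omega> by (intro compact_continuous_image) (auto intro: continuous_on_subset simp: compact_closure)
  then show "bounded (h ` \<Omega>)"
    using closure_subset[of \<Omega>] by (meson bounded_subset compact_imp_bounded image_mono)
qed

lemma L2_times_continuous:
  fixes f h :: "'a::euclidean_space \<Rightarrow> real"
  assumes "open \<Omega>" "bounded \<Omega>" "f \<in> L2 \<Omega>" "continuous_on UNIV h"
  shows "set_integrable lebesgue \<Omega> (\<lambda>x. f x * h x)"
  using L2_set_integrable_inner[OF assms(3) continuous_in_L2[OF assms(1,2,4)]] by simp

section \<open>Linearity of the weak gradient\<close>

lemma test_function_derivative_continuous:
  "\<theta> \<in> test_functions \<Omega> \<Longrightarrow> continuous_on UNIV (\<lambda>x. frechet_derivative \<theta> (at x) (axis i (1::real)))"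
  using test_functionD(1)[of \<theta> \<Omega> 1] by simp

lemma has_weak_grad_lincomb:
  fixes \<Omega> :: "(real ^ 'd) set"
  assumes \<Omega>: "open \<Omega>" "bounded \<Omega>" and L2: "u \<in> L2 \<Omega>" "v \<in> L2 \<Omega>" "g \<in> L2 \<Omega>" "k \<in> L2 \<Omega>"
    and g: "has_weak_grad \<Omega> u g" and k: "has_weak_grad \<Omega> v k"
  shows "has_weak_grad \<Omega> (\<lambda>x. a * u x + b * v x) (\<lambda>x. a *\<^sub>R g x + b *\<^sub>R k x)"
  unfolding has_weak_grad_def
proof (intro ballI allI)
  fix \<theta> i assume \<theta>: "\<theta> \<in> test_functions \<Omega>"
  let ?d = "\<lambda>x. frechet_derivative \<theta> (at x) (axis i 1)"
  note d = test_function_derivative_continuous[OF \<theta>, of i]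
  note t = C_k_continuous[OF test_functionD(1)[OF \<theta>, of 0]]
  have "(LINT x:\<Omega>|lebesgue. (a * u x + b * v x) * ?d x)
      = (LINT x:\<Omega>|lebesgue. a * (u x * ?d x) + b * (v x * ?d x))"
    by (simp add: algebra_simps)
  also have "\<dots> = a * (LINT x:\<Omega>|lebesgue. u x * ?d x) + b * (LINT x:\<Omega>|lebesgue. v x * ?d x)"
    using L2_times_continuous[OF \<Omega> L2(1) d] L2_times_continuous[OF \<Omega> L2(2) d] by simp
  also have "\<dots> = - (a * (LINT x:\<Omega>|lebesgue. g x $ i * \<theta> x) + b * (LINT x:\<Omega>|lebesgue. k x $ i * \<theta> x))"
    using g k \<theta> by (simp add: has_weak_grad_def)
  also have "\<dots> = - (LINT x:\<Omega>|lebesgue. a * (g x $ i * \<theta> x) + b * (k x $ i * \<theta> x))"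
    using L2_times_continuous[OF \<Omega> L2_component[OF L2(3)] t]
      L2_times_continuous[OF \<Omega> L2_component[OF L2(4)] t] by simp
  also have "\<dots> = - (LINT x:\<Omega>|lebesgue. (a *\<^sub>R g x + b *\<^sub>R k x) $ i * \<theta> x)"
    by (simp add: algebra_simps)
  finally show "(LINT x:\<Omega>|lebesgue. (a * u x + b * v x) * ?d x)
      = - (LINT x:\<Omega>|lebesgue. (a *\<^sub>R g x + b *\<^sub>R k x) $ i * \<theta> x)" .
qed

text \<open>
  The components of \<open>g - k\<close> are orthogonal to every test function.
\<close>

lemma has_weak_grad_unique:
  fixes \<Omega> :: "(real ^ 'd) set"
  assumes \<Omega>: "open \<Omega>" "bounded \<Omega>" and L2: "g \<in> L2 \<Omega>" "k \<in> L2 \<Omega>"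
    and g: "has_weak_grad \<Omega> u g" and k: "has_weak_grad \<Omega> u k"
  shows "AE x in lebesgue. x \<in> \<Omega> \<longrightarrow> g x = k x"
proof -
  have "AE x in lebesgue. x \<in> \<Omega> \<longrightarrow> g x $ i - k x $ i = 0" for i
  proof (rule test_functions_fundamental[OF \<Omega>(1)])
    have int: "set_integrable lebesgue \<Omega> (\<lambda>x. f x $ i * \<theta> x)"
      if "f \<in> L2 \<Omega>" "continuous_on UNIV \<theta>" for f :: "real ^ 'd \<Rightarrow> real ^ 'd" and \<theta>
      using L2_times_continuous[OF \<Omega> L2_component[OF that(1)] that(2)] .
    show "set_integrable lebesgue \<Omega> (\<lambda>x. g x $ i - k x $ i)"
      using int[OF L2(1), of "\<lambda>_. 1"] int[OF L2(2), of "\<lambda>_. 1"] by simp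
    fix \<theta> assume \<theta>: "\<theta> \<in> test_functions \<Omega>"
    note t = C_k_continuous[OF test_functionD(1)[OF \<theta>, of 0]]
    have "(LINT x:\<Omega>|lebesgue. g x $ i * \<theta> x) = (LINT x:\<Omega>|lebesgue. k x $ i * \<theta> x)"
      using trans[OF g[unfolded has_weak_grad_def, rule_format, OF \<theta>, of i, symmetric]
          k[unfolded has_weak_grad_def, rule_format, OF \<theta>, of i]] by (rule neg_equal_iff_equal[THEN iffD1])
    then show "(LINT x:\<Omega>|lebesgue. (g x $ i - k x $ i) * \<theta> x) = 0"
      using int[OF L2(1) t] int[OF L2(2) t] by (simp add: left_diff_distrib)
  qed
  then have "AE x in lebesgue. \<forall>i. x \<in> \<Omega> \<longrightarrow> g x $ i - k x $ i = 0"
    by (intro AE_all_countable[THEN iffD2] allI)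
  then show ?thesis
    by eventually_elim (simp add: vec_eq_iff)
qed

lemma grad_weak_grad:
  assumes "u \<in> H1 \<Omega>"
  shows "grad \<Omega> u \<in> L2 \<Omega>" "has_weak_grad \<Omega> u (grad \<Omega> u)"
proof -
  have "\<exists>g. g \<in> L2 \<Omega> \<and> has_weak_grad \<Omega> u g"
    using assms by (auto simp: H1_def)
  from someI_ex[OF this] show "grad \<Omega> u \<in> L2 \<Omega>" "has_weak_grad \<Omega> u (grad \<Omega> u)"
    by (auto simp: grad_def)
qed

lemma H1_imp_L2: "u \<in> H1 \<Omega> \<Longrightarrow> u \<in> L2 \<Omega>"
  by (simp add: H1_def)

text \<open>
  \<^const>\<open>grad\<close> is a choice of one weak gradient per function, so linearity holds only almost
  everywhere, and only because weak gradients are unique up to null sets.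
\<close>

lemma grad_lincomb:
  fixes \<Omega> :: "(real ^ 'd) set"
  assumes \<Omega>: "open \<Omega>" "bounded \<Omega>" and u: "u \<in> H1 \<Omega>" and v: "v \<in> H1 \<Omega>"
  shows "(\<lambda>x. a * u x + b * v x) \<in> H1 \<Omega>"
    and "AE x in lebesgue. x \<in> \<Omega> \<longrightarrow>
      grad \<Omega> (\<lambda>x. a * u x + b * v x) x = a *\<^sub>R grad \<Omega> u x + b *\<^sub>R grad \<Omega> v x"
proof -
  note gu = grad_weak_grad[OF u] and gv = grad_weak_grad[OF v]
  have L2: "(\<lambda>x. a *\<^sub>R grad \<Omega> u x + b *\<^sub>R grad \<Omega> v x) \<in> L2 \<Omega>"
    by (rule L2_lincomb[OF gu(1) gv(1)])
  have wg: "has_weak_grad \<Omega> (\<lambda>x. a * u x + b * v x) (\<lambda>x. a *\<^sub>R grad \<Omega> u x + b *\<^sub>R grad \<Omega> v x)"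
    by (rule has_weak_grad_lincomb[OF \<Omega> H1_imp_L2[OF u] H1_imp_L2[OF v] gu(1) gv(1) gu(2) gv(2)])
  have "(\<lambda>x. a * u x + b * v x) \<in> L2 \<Omega>"
    using L2_lincomb[OF H1_imp_L2[OF u] H1_imp_L2[OF v], of a b] by simp
  with L2 wg show H1: "(\<lambda>x. a * u x + b * v x) \<in> H1 \<Omega>"
    by (auto simp: H1_def)
  show "AE x in lebesgue. x \<in> \<Omega> \<longrightarrow>
      grad \<Omega> (\<lambda>x. a * u x + b * v x) x = a *\<^sub>R grad \<Omega> u x + b *\<^sub>R grad \<Omega> v x"
    by (rule has_weak_grad_unique[OF \<Omega> grad_weak_grad(1)[OF H1] L2 grad_weak_grad(2)[OF H1] wg])
qed

text \<open>
  Transports the almost everywhere linearity of the gradient into inner products.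
\<close>

lemma ip_cong_AE:
  assumes "f \<in> L2 \<Omega>" "f' \<in> L2 \<Omega>" "g \<in> L2 \<Omega>" "g' \<in> L2 \<Omega>"
    and "AE x in lebesgue. x \<in> \<Omega> \<longrightarrow> f x = f' x" "AE x in lebesgue. x \<in> \<Omega> \<longrightarrow> g x = g' x"
  shows "ip \<Omega> f g = ip \<Omega> f' g'"
  unfolding ip_def set_lebesgue_integral_def
proof (rule integral_cong_AE)
  show "(\<lambda>x. indicator \<Omega> x *\<^sub>R (f x \<bullet> g x)) \<in> borel_measurable lebesgue"
    "(\<lambda>x. indicator \<Omega> x *\<^sub>R (f' x \<bullet> g' x)) \<in> borel_measurable lebesgue"
    using L2_set_integrable_inner[OF assms(1,3)] L2_set_integrable_inner[OF assms(2,4)]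
    unfolding set_integrable_def by (auto intro: borel_measurable_integrable)
  show "AE x in lebesgue. indicator \<Omega> x *\<^sub>R (f x \<bullet> g x) = indicator \<Omega> x *\<^sub>R (f' x \<bullet> g' x)"
    using assms(5,6) by eventually_elim (auto simp: indicator_def)
qed

lemma nrm_power2: "(nrm \<Omega> f)\<^sup>2 = ip \<Omega> f f"
proof -
  have "0 \<le> ip \<Omega> f f"
    unfolding ip_def set_lebesgue_integral_def by (rule integral_nonneg_AE) simp
  then show ?thesis by (simp add: nrm_def)
qed

lemma ip_scale_left: "ip \<Omega> (\<lambda>x. a *\<^sub>R f x) g = a * ip \<Omega> f g"
  by (simp add: ip_def)

lemma ip_scale_right: "ip \<Omega> f (\<lambda>x. a *\<^sub>R g x) = a * ip \<Omega> f g"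
  by (simp add: ip_def)

lemma ip_commute: "ip \<Omega> f g = ip \<Omega> g f"
  by (simp add: ip_def inner_commute)

lemma ip_lincomb_left:
  assumes "f \<in> L2 \<Omega>" "g \<in> L2 \<Omega>" "k \<in> L2 \<Omega>"
  shows "ip \<Omega> (\<lambda>x. a *\<^sub>R f x + b *\<^sub>R g x) k = a * ip \<Omega> f k + b * ip \<Omega> g k"
  using L2_set_integrable_inner[OF assms(1,3)] L2_set_integrable_inner[OF assms(2,3)]
  by (simp add: ip_def inner_add_left)

lemma ip_lincomb_right:
  assumes "f \<in> L2 \<Omega>" "g \<in> L2 \<Omega>" "k \<in> L2 \<Omega>"
  shows "ip \<Omega> k (\<lambda>x. a *\<^sub>R f x + b *\<^sub>R g x) = a * ip \<Omega> k f + b * ip \<Omega> k g"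
  using ip_lincomb_left[OF assms] by (simp add: ip_commute[of _ k])

section \<open>Midpoints of functions with zero trace\<close>

text \<open>
  Equivalent to \<open>\<parallel>f - g\<parallel>\<^sup>2 \<ge> 0\<close>. Convexity of the squared norm replaces the triangle inequality in
  approximating midpoints.
\<close>

lemma nrm_midpoint:
  assumes f: "f \<in> L2 \<Omega>" and g: "g \<in> L2 \<Omega>"
  shows "(nrm \<Omega> (\<lambda>x. (1/2) *\<^sub>R f x + (1/2) *\<^sub>R g x))\<^sup>2 \<le> 1/2 * (nrm \<Omega> f)\<^sup>2 + 1/2 * (nrm \<Omega> g)\<^sup>2"
proof -
  have "0 \<le> (nrm \<Omega> (\<lambda>x. 1 *\<^sub>R f x + (-1) *\<^sub>R g x))\<^sup>2" by simp
  then have "0 \<le> ip \<Omega> f f - 2 * ip \<Omega> f g + ip \<Omega> g g"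
    unfolding nrm_power2 ip_lincomb_left[OF f g L2_lincomb[OF f g]]
      ip_lincomb_right[OF f g f] ip_lincomb_right[OF f g g] ip_commute[of \<Omega> g f] by simp
  then show ?thesis
    unfolding nrm_power2 ip_lincomb_left[OF f g L2_lincomb[OF f g]]
      ip_lincomb_right[OF f g f] ip_lincomb_right[OF f g g] ip_commute[of \<Omega> g f]
    by (simp add: field_simps)
qed

lemma test_function_in_H1:
  fixes \<Omega> :: "(real ^ 'd) set"
  assumes \<Omega>: "open \<Omega>" "bounded \<Omega>" and \<theta>: "\<theta> \<in> test_functions \<Omega>"
  shows "\<theta> \<in> H1 \<Omega>"
proof -
  obtain R where R: "\<Omega> \<subseteq> ball 0 R" using bounded_subset_ballD[OF \<Omega>(2)] by blast
  have "piecewise_C1 {cball 0 R} \<theta>"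
    using test_functionD(1)[OF \<theta>, of 1] by (auto simp: piecewise_C1_def)
  moreover have "\<Omega> \<subseteq> \<Union>{cball 0 R}" using R ball_subset_cball by auto
  moreover have "continuous_on \<Omega> \<theta>" by (rule C_k_continuous_on[OF test_functionD(1)[OF \<theta>, of 0]])
  ultimately show ?thesis
    by (intro piecewise_C1_in_H1(1)[OF \<Omega>(1)])
qed

lemma test_functions_lincomb:
  assumes \<theta>: "\<theta> \<in> test_functions \<Omega>" and \<zeta>: "\<zeta> \<in> test_functions \<Omega>"
  shows "(\<lambda>x. a * \<theta> x + b * \<zeta> x) \<in> test_functions \<Omega>"
proof -
  let ?S = "closure {x. \<theta> x \<noteq> 0} \<union> closure {x. \<zeta> x \<noteq> 0}"
  have S: "compact ?S" "?S \<subseteq> \<Omega>"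
    using test_functionD(2,3)[OF \<theta>] test_functionD(2,3)[OF \<zeta>] by auto
  have "{x. a * \<theta> x + b * \<zeta> x \<noteq> 0} \<subseteq> ?S"
  proof
    fix x assume "x \<in> {x. a * \<theta> x + b * \<zeta> x \<noteq> 0}"
    then have "x \<in> {x. \<theta> x \<noteq> 0} \<or> x \<in> {x. \<zeta> x \<noteq> 0}" by auto
    then show "x \<in> ?S"
      using closure_subset[of "{x. \<theta> x \<noteq> 0}"] closure_subset[of "{x. \<zeta> x \<noteq> 0}"] by blast
  qed
  then have sub: "closure {x. a * \<theta> x + b * \<zeta> x \<noteq> 0} \<subseteq> ?S"
    by (rule closure_minimal) auto
  then have "compact (closure {x. a * \<theta> x + b * \<zeta> x \<noteq> 0})"
    using compact_Int_closed[OF S(1) closed_closure[of "{x. a * \<theta> x + b * \<zeta> x \<noteq> 0}"]]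
    by (simp only: Int_absorb1)
  moreover have "C_k k (\<lambda>x. a * \<theta> x + b * \<zeta> x)" for k
    using test_functionD(1)[OF \<theta>] test_functionD(1)[OF \<zeta>] by (intro C_k_add C_k_mult C_k_const)
  ultimately show ?thesis
    using order_trans[OF sub S(2)] unfolding test_functions_def by blast
qed

lemma H1_norm_power2: "(H1_norm \<Omega> u)\<^sup>2 = (nrm \<Omega> u)\<^sup>2 + (nrm \<Omega> (grad \<Omega> u))\<^sup>2"
  by (simp add: H1_norm_def)

lemma H1_norm_midpoint:
  assumes \<Omega>: "open \<Omega>" "bounded \<Omega>" and u: "u \<in> H1 \<Omega>" and v: "v \<in> H1 \<Omega>"
  shows "(H1_norm \<Omega> (\<lambda>x. 1/2 * u x + 1/2 * v x))\<^sup>2 \<le> 1/2 * (H1_norm \<Omega> u)\<^sup>2 + 1/2 * (H1_norm \<Omega> v)\<^sup>2"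
proof -
  note g = grad_lincomb[OF \<Omega> u v, of "1/2" "1/2"]
  note gu = grad_weak_grad(1)[OF u] and gv = grad_weak_grad(1)[OF v]
  have "(nrm \<Omega> (grad \<Omega> (\<lambda>x. 1/2 * u x + 1/2 * v x)))\<^sup>2
      = (nrm \<Omega> (\<lambda>x. (1/2) *\<^sub>R grad \<Omega> u x + (1/2) *\<^sub>R grad \<Omega> v x))\<^sup>2"
    unfolding nrm_power2
    by (intro ip_cong_AE g(2) grad_weak_grad(1)[OF g(1)] L2_lincomb gu gv)
  with nrm_midpoint[OF gu gv] nrm_midpoint[OF H1_imp_L2[OF u] H1_imp_L2[OF v]]
  show ?thesis by (simp add: H1_norm_power2 add_divide_distrib)
qed

text \<open>
  Midpoints of approximating test functions approximate the midpoint. Comparing the norms needs the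
  linearity of the gradient on the differences, and hence that test functions lie in \<open>H1\<close>.
\<close>

lemma H10_midpoint:
  fixes \<Omega> :: "(real ^ 'd) set"
  assumes \<Omega>: "open \<Omega>" "bounded \<Omega>" and u: "u \<in> H10 \<Omega>" and v: "v \<in> H10 \<Omega>"
  shows "(\<lambda>x. 1/2 * u x + 1/2 * v x) \<in> H10 \<Omega>"
proof -
  have uH: "u \<in> H1 \<Omega>" and vH: "v \<in> H1 \<Omega>" using u v by (auto simp: H10_def)
  have "\<exists>\<theta>\<in>test_functions \<Omega>. H1_norm \<Omega> (\<lambda>x. (1/2 * u x + 1/2 * v x) - \<theta> x) < e" if e: "e > 0" for e
  proof -
    obtain \<theta> \<zeta> where \<theta>: "\<theta> \<in> test_functions \<Omega>" "H1_norm \<Omega> (\<lambda>x. u x - \<theta> x) < e"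
      and \<zeta>: "\<zeta> \<in> test_functions \<Omega>" "H1_norm \<Omega> (\<lambda>x. v x - \<zeta> x) < e"
      using u v e unfolding H10_def by blast
    have d: "(\<lambda>x. u x - \<theta> x) \<in> H1 \<Omega>" "(\<lambda>x. v x - \<zeta> x) \<in> H1 \<Omega>"
      using grad_lincomb(1)[OF \<Omega> uH test_function_in_H1[OF \<Omega> \<theta>(1)], of 1 "-1"]
        grad_lincomb(1)[OF \<Omega> vH test_function_in_H1[OF \<Omega> \<zeta>(1)], of 1 "-1"] by simp_all
    have n0: "0 \<le> H1_norm \<Omega> w" for w by (simp add: H1_norm_def)
    have "(\<lambda>x. (1/2 * u x + 1/2 * v x) - (1/2 * \<theta> x + 1/2 * \<zeta> x))
        = (\<lambda>x. 1/2 * (u x - \<theta> x) + 1/2 * (v x - \<zeta> x))"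
      by (simp add: fun_eq_iff field_simps)
    with H1_norm_midpoint[OF \<Omega> d]
    have "(H1_norm \<Omega> (\<lambda>x. (1/2 * u x + 1/2 * v x) - (1/2 * \<theta> x + 1/2 * \<zeta> x)))\<^sup>2
        \<le> 1/2 * (H1_norm \<Omega> (\<lambda>x. u x - \<theta> x))\<^sup>2 + 1/2 * (H1_norm \<Omega> (\<lambda>x. v x - \<zeta> x))\<^sup>2"
      by simp
    also have "\<dots> < e\<^sup>2"
      using power_strict_mono[OF \<theta>(2) n0, of 2] power_strict_mono[OF \<zeta>(2) n0, of 2] by simp
    finally have "H1_norm \<Omega> (\<lambda>x. (1/2 * u x + 1/2 * v x) - (1/2 * \<theta> x + 1/2 * \<zeta> x)) < e"
      using e by (simp add: power_less_imp_less_base)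
    then show ?thesis by (rule bexI[OF _ test_functions_lincomb[OF \<theta>(1) \<zeta>(1)]])
  qed
  then show ?thesis
    using grad_lincomb(1)[OF \<Omega> uH vH, of "1/2" "1/2"] by (simp add: H10_def)
qed

section \<open>Finite element functions\<close>

lemma polys_C_k:
  assumes "P \<in> polys r"
  shows "C_k k P"
proof -
  obtain c where c: "P = (\<lambda>x. \<Sum>\<alpha> | (\<Sum>i\<in>UNIV. \<alpha> i) \<le> r. c \<alpha> * (\<Prod>i\<in>UNIV. (x $ i) ^ \<alpha> i))"
    using assms by (auto simp: polys_def fun_eq_iff)
  show ?thesis
    unfolding c cart_eq_inner_axis
    by (intro C_k_sum C_k_mult C_k_prod C_k_power C_k_const C_k_inner)
qed

lemma polys_lincomb:
  assumes "P \<in> polys r" "Q \<in> polys r"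
  shows "(\<lambda>x. a * P x + b * Q x) \<in> polys r"
proof -
  obtain c d where c: "\<And>x. P x = (\<Sum>\<alpha> | (\<Sum>i\<in>UNIV. \<alpha> i) \<le> r. c \<alpha> * (\<Prod>i\<in>UNIV. (x $ i) ^ \<alpha> i))"
    and d: "\<And>x. Q x = (\<Sum>\<alpha> | (\<Sum>i\<in>UNIV. \<alpha> i) \<le> r. d \<alpha> * (\<Prod>i\<in>UNIV. (x $ i) ^ \<alpha> i))"
    using assms unfolding polys_def by blast
  have "a * P x + b * Q x = (\<Sum>\<alpha> | (\<Sum>i\<in>UNIV. \<alpha> i) \<le> r.
      (a * c \<alpha> + b * d \<alpha>) * (\<Prod>i\<in>UNIV. (x $ i) ^ \<alpha> i))" for x
    unfolding c d sum_distrib_left sum.distrib[symmetric] by (simp add: algebra_simps)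
  then show ?thesis unfolding polys_def mem_Collect_eq by (intro exI[of _ "\<lambda>\<alpha>. a * c \<alpha> + b * d \<alpha>"]) blast
qed

lemma Mh_lincomb:
  assumes u: "u \<in> Mh \<Omega> Tr r" and v: "v \<in> Mh \<Omega> Tr r"
  shows "(\<lambda>x. a * u x + b * v x) \<in> Mh \<Omega> Tr r"
proof -
  have "\<exists>P\<in>polys r. \<forall>x\<in>K. a * u x + b * v x = P x" if "K \<in> Tr" for K
  proof -
    obtain P Q where "P \<in> polys r" "\<forall>x\<in>K. u x = P x" "Q \<in> polys r" "\<forall>x\<in>K. v x = Q x"
      using u v \<open>K \<in> Tr\<close> unfolding Mh_def by blast
    then show ?thesis
      by (intro bexI[OF _ polys_lincomb[of P r Q a b]]) auto
  qed
  then show ?thesis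
    using u v by (auto simp: Mh_def intro!: continuous_intros)
qed

lemma mesh_on_simplex: "mesh_on \<Omega> Tr \<Longrightarrow> K \<in> Tr \<Longrightarrow> compact K \<and> convex K"
  unfolding mesh_on_def
  by (meson polytope_imp_compact polytope_imp_convex simplex_imp_polytope)

lemma mesh_on_finite: "mesh_on \<Omega> Tr \<Longrightarrow> finite Tr"
  by (auto simp: mesh_on_def triangulation_def simplicial_complex_def)

lemma mesh_on_subset: "mesh_on \<Omega> Tr \<Longrightarrow> \<Omega> \<subseteq> \<Union>Tr"
  using closure_subset[of \<Omega>] by (auto simp: mesh_on_def)

lemma mesh_on_bounded: "mesh_on \<Omega> Tr \<Longrightarrow> bounded \<Omega>"
  by (meson mesh_on_subset mesh_on_finite mesh_on_simplex bounded_Union bounded_subset compact_imp_bounded)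

lemma Mh_piecewise_C1:
  assumes mesh: "mesh_on \<Omega> Tr" and v: "v \<in> Mh \<Omega> Tr r"
  shows "piecewise_C1 Tr v"
  unfolding piecewise_C1_def
proof (intro conjI ballI)
  show "finite Tr" by (rule mesh_on_finite[OF mesh])
  fix K assume K: "K \<in> Tr"
  show "compact K" "convex K" using mesh_on_simplex[OF mesh K] by auto
  obtain P where "P \<in> polys r" "\<forall>x\<in>K. v x = P x" using v K unfolding Mh_def by blast
  then show "\<exists>P. C_k 1 P \<and> (\<forall>x\<in>K. v x = P x)" using polys_C_k[of P r 1] by blast
qed

lemma Mh_in_H1:
  assumes "open \<Omega>" "mesh_on \<Omega> Tr" and v: "v \<in> Mh \<Omega> Tr r"
  shows "v \<in> H1 \<Omega>" and "bounded (v ` \<Omega>)"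
proof -
  have "continuous_on \<Omega> v" using v unfolding Mh_def by blast
  from piecewise_C1_in_H1[OF assms(1) mesh_on_subset[OF assms(2)] Mh_piecewise_C1[OF assms(2,3)] this]
  show "v \<in> H1 \<Omega>" "bounded (v ` \<Omega>)" .
qed

section \<open>Integrability and admissible test functions in the discrete spaces\<close>

text \<open>
  Finite element functions enter the double-well energy with their fourth powers; this algebra of
  functions provides integrability of all polynomial expressions in them.
\<close>

definition bounded_cont :: "'a::euclidean_space set \<Rightarrow> ('a \<Rightarrow> real) \<Rightarrow> bool" where
  "bounded_cont \<Omega> f \<longleftrightarrow> continuous_on \<Omega> f \<and> (\<exists>B. \<forall>x\<in>\<Omega>. \<bar>f x\<bar> \<le> B)"

lemma bounded_cont_const: "bounded_cont \<Omega> (\<lambda>x. c)"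
  by (auto simp: bounded_cont_def)

lemma bounded_cont_add:
  assumes "bounded_cont \<Omega> f" "bounded_cont \<Omega> g"
  shows "bounded_cont \<Omega> (\<lambda>x. f x + g x)"
proof -
  obtain B C where "\<forall>x\<in>\<Omega>. \<bar>f x\<bar> \<le> B" "\<forall>x\<in>\<Omega>. \<bar>g x\<bar> \<le> C"
    using assms by (auto simp: bounded_cont_def)
  then have "\<forall>x\<in>\<Omega>. \<bar>f x + g x\<bar> \<le> B + C" by (fastforce intro: order_trans[OF abs_triangle_ineq])
  with assms show ?thesis by (auto simp: bounded_cont_def intro: continuous_on_add)
qed

lemma bounded_cont_mult:
  assumes "bounded_cont \<Omega> f" "bounded_cont \<Omega> g"
  shows "bounded_cont \<Omega> (\<lambda>x. f x * g x)"
proof -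
  obtain B C where BC: "\<forall>x\<in>\<Omega>. \<bar>f x\<bar> \<le> B" "\<forall>x\<in>\<Omega>. \<bar>g x\<bar> \<le> C"
    using assms by (auto simp: bounded_cont_def)
  have "\<bar>f x * g x\<bar> \<le> B * C" if "x \<in> \<Omega>" for x
    unfolding abs_mult using BC that by (intro mult_mono) (auto intro: order_trans[OF abs_ge_zero])
  with assms show ?thesis by (auto simp: bounded_cont_def intro: continuous_on_mult)
qed

lemma bounded_cont_diff:
  "bounded_cont \<Omega> f \<Longrightarrow> bounded_cont \<Omega> g \<Longrightarrow> bounded_cont \<Omega> (\<lambda>x. f x - g x)"
  using bounded_cont_add[OF _ bounded_cont_mult[OF bounded_cont_const[of \<Omega> "-1"]], of f g] by simp

lemma bounded_cont_power: "bounded_cont \<Omega> f \<Longrightarrow> bounded_cont \<Omega> (\<lambda>x. f x ^ n)"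
proof (induction n)
  case 0
  show ?case using bounded_cont_const[of \<Omega> 1] by simp
next
  case (Suc n)
  show ?case using bounded_cont_mult[OF Suc.prems Suc.IH[OF Suc.prems]] by simp
qed

lemmas bounded_cont_intros =
  bounded_cont_add bounded_cont_mult bounded_cont_diff bounded_cont_power bounded_cont_const

lemma bounded_cont_L2:
  "open \<Omega> \<Longrightarrow> bounded \<Omega> \<Longrightarrow> bounded_cont \<Omega> f \<Longrightarrow> f \<in> L2 \<Omega>"
  by (rule continuous_bounded_in_L2) (auto simp: bounded_cont_def bounded_iff)

lemma bounded_cont_set_integrable:
  assumes "open \<Omega>" "bounded \<Omega>" "bounded_cont \<Omega> f"
  shows "set_integrable lebesgue \<Omega> f"
  using L2_times_continuous[OF assms(1,2) bounded_cont_L2[OF assms], of "\<lambda>_. 1"] by simp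

lemma Mh_bounded_cont:
  assumes "open \<Omega>" "mesh_on \<Omega> Tr" "v \<in> Mh \<Omega> Tr r"
  shows "bounded_cont \<Omega> v"
  using Mh_in_H1(2)[OF assms] assms(3) by (auto simp: bounded_cont_def bounded_iff Mh_def)

lemma L2_diff:
  fixes f g :: "'a::euclidean_space \<Rightarrow> 'b::euclidean_space"
  shows "f \<in> L2 \<Omega> \<Longrightarrow> g \<in> L2 \<Omega> \<Longrightarrow> (\<lambda>x. f x - g x) \<in> L2 \<Omega>"
  using L2_lincomb[of f \<Omega> g 1 "-1"] by simp

lemma Xh_in_L2:
  fixes \<Omega> :: "(real ^ 'd) set"
  assumes "open \<Omega>" "mesh_on \<Omega> Tr" "u \<in> Xh \<Omega> Tr q"
  shows "u \<in> L2 \<Omega>"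
proof (rule continuous_bounded_in_L2[OF assms(1) mesh_on_bounded[OF assms(2)]])
  have bc: "bounded_cont \<Omega> (\<lambda>x. u x $ i)" for i
    using assms by (intro Mh_bounded_cont) (auto simp: Xh_def Mh0_def)
  then have "continuous_on \<Omega> (\<lambda>x. \<chi> i. u x $ i)"
    unfolding bounded_cont_def by (intro continuous_on_vec_lambda) blast
  then show "continuous_on \<Omega> u" by simp
  have "\<forall>i. \<exists>B. \<forall>x\<in>\<Omega>. \<bar>u x $ i\<bar> \<le> B" using bc by (auto simp: bounded_cont_def)
  from choice[OF this] obtain B where B: "\<forall>i. \<forall>x\<in>\<Omega>. \<bar>u x $ i\<bar> \<le> B i" ..
  have "norm (u x) \<le> (\<Sum>i\<in>UNIV. B i)" if "x \<in> \<Omega>" for x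
    using norm_le_l1_cart[of "u x"] sum_mono[of UNIV "\<lambda>i. \<bar>u x $ i\<bar>" B] B that by fastforce
  then show "bounded (u ` \<Omega>)" by (auto simp: bounded_iff)
qed

lemma bar_in_Xh:
  fixes \<Omega> :: "(real ^ 'd) set"
  assumes \<Omega>: "open \<Omega>" "mesh_on \<Omega> Tr" and u: "u (m + 1) \<in> Xh \<Omega> Tr q" "u m \<in> Xh \<Omega> Tr q"
  shows "bar u m \<in> Xh \<Omega> Tr q"
  unfolding Xh_def mem_Collect_eq
proof
  fix i
  have "(\<lambda>x. u (m + 1) x $ i) \<in> Mh0 \<Omega> Tr (q + 1)" "(\<lambda>x. u m x $ i) \<in> Mh0 \<Omega> Tr (q + 1)"
    using u unfolding Xh_def by blast+
  then have "(\<lambda>x. 1/2 * u (m + 1) x $ i + 1/2 * u m x $ i) \<in> Mh0 \<Omega> Tr (q + 1)"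
    unfolding Mh0_def using Mh_lincomb H10_midpoint[OF \<Omega>(1) mesh_on_bounded[OF \<Omega>(2)]] by blast
  then show "(\<lambda>x. bar u m x $ i) \<in> Mh0 \<Omega> Tr (q + 1)"
    by (simp add: bar_def)
qed

lemma bar_in_Sh0:
  assumes \<Omega>: "open \<Omega>" "bounded \<Omega>" and p: "p (m + 1) \<in> Sh0 \<Omega> Tr q" "p m \<in> Sh0 \<Omega> Tr q"
  shows "bar p m \<in> Sh0 \<Omega> Tr q"
proof -
  have L2: "p (m + 1) \<in> L2 \<Omega>" "p m \<in> L2 \<Omega>" using p by (auto simp: Sh0_def L20_def)
  have "set_integrable lebesgue \<Omega> (p (m + 1))" "set_integrable lebesgue \<Omega> (p m)"
    using L2_times_continuous[OF \<Omega> L2(1), of "\<lambda>_. 1"] L2_times_continuous[OF \<Omega> L2(2), of "\<lambda>_. 1"]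
    by simp_all
  then have "(LINT x:\<Omega>|lebesgue. bar p m x) = 0"
    using p by (simp add: bar_def Sh0_def L20_def)
  moreover have "bar p m \<in> L2 \<Omega>"
    unfolding bar_def by (rule L2_lincomb[OF L2])
  moreover have "bar p m \<in> Sh \<Omega> Tr q"
    using p Mh_lincomb[of "p (m + 1)" \<Omega> Tr q "p m" "1/2" "1/2"] by (simp add: bar_def Sh0_def Sh_def)
  ultimately show ?thesis by (simp add: Sh0_def L20_def)
qed

section \<open>Energy balance\<close>

text \<open>
  With \<open>d = c - b\<close> and \<open>e = b - a\<close>, the left integrand is \<open>d \<bullet> (b + d/2 + (d - e)/4)\<close>; here
  \<open>d \<bullet> (b + d/2)\<close> is half the difference of the squares of \<open>c\<close> and \<open>b\<close>, and \<open>2 d \<bullet> (d - e)\<close> is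
  \<open>\<bar>d\<bar>\<^sup>2 - \<bar>e\<bar>\<^sup>2 + \<bar>d - e\<bar>\<^sup>2\<close>.
\<close>

lemma gradient_identity:
  fixes a b c :: "'a::euclidean_space \<Rightarrow> 'b::euclidean_space"
  assumes "a \<in> L2 \<Omega>" "b \<in> L2 \<Omega>" "c \<in> L2 \<Omega>"
  shows "ip \<Omega> (\<lambda>x. (3/4) *\<^sub>R c x + (1/4) *\<^sub>R a x) (\<lambda>x. c x - b x)
    = 1/2 * ((nrm \<Omega> c)\<^sup>2 - (nrm \<Omega> b)\<^sup>2)
      + 1/8 * ((nrm \<Omega> (\<lambda>x. c x - b x))\<^sup>2 - (nrm \<Omega> (\<lambda>x. b x - a x))\<^sup>2
        + (nrm \<Omega> (\<lambda>x. c x - 2 *\<^sub>R b x + a x))\<^sup>2)"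
proof -
  have "(\<lambda>x. c x - 2 *\<^sub>R b x + a x) \<in> L2 \<Omega>"
    using L2_lincomb[OF L2_lincomb[OF assms(3,2), of 1 "-2"] assms(1), of 1 1] by simp
  note int = L2_set_integrable_inner[OF assms(2) assms(2)] L2_set_integrable_inner[OF assms(3) assms(3)]
    L2_set_integrable_inner[OF L2_diff[OF assms(3,2)] L2_diff[OF assms(3,2)]]
    L2_set_integrable_inner[OF L2_diff[OF assms(2,1)] L2_diff[OF assms(2,1)]]
    L2_set_integrable_inner[OF this this]
  have "((3/4) *\<^sub>R c x + (1/4) *\<^sub>R a x) \<bullet> (c x - b x)
      = 1/2 * (c x \<bullet> c x - b x \<bullet> b x) + 1/8 * ((c x - b x) \<bullet> (c x - b x) - (b x - a x) \<bullet> (b x - a x)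
        + (c x - 2 *\<^sub>R b x + a x) \<bullet> (c x - 2 *\<^sub>R b x + a x))" for x
    by (simp add: inner_add_left inner_add_right inner_diff_left inner_diff_right
        inner_commute[of "a x" "b x"] inner_commute[of "a x" "c x"] inner_commute[of "b x" "c x"]
        field_simps)
  then show ?thesis
    unfolding nrm_power2 ip_def using int by simp
qed

text \<open>
  The averaged cubic term is built so that its product with \<open>c - b\<close> is \<open>(c\<^sup>4 - b\<^sup>4) / 4\<close>, and the
  extrapolation \<open>3/2 b - 1/2 a\<close> differs from the average of \<open>b\<close> and \<open>c\<close> by half the second
  difference with the opposite sign, which yields the numerical dissipation.
\<close>

lemma double_well_identity:
  assumes \<Omega>: "open \<Omega>" "bounded \<Omega>"
    and bc: "bounded_cont \<Omega> a" "bounded_cont \<Omega> b" "bounded_cont \<Omega> c"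
  shows "ip \<Omega> (\<lambda>x. 1/2 * ((c x)\<^sup>2 + (b x)\<^sup>2) * (1/2 * c x + 1/2 * b x)) (\<lambda>x. c x - b x)
      - ip \<Omega> (\<lambda>x. 3/2 * b x - 1/2 * a x) (\<lambda>x. c x - b x)
    = 1/4 * ((LINT x:\<Omega>|lebesgue. ((c x)\<^sup>2 - 1)\<^sup>2) - (LINT x:\<Omega>|lebesgue. ((b x)\<^sup>2 - 1)\<^sup>2))
      + 1/4 * ((nrm \<Omega> (\<lambda>x. c x - b x))\<^sup>2 - (nrm \<Omega> (\<lambda>x. b x - a x))\<^sup>2
        + (nrm \<Omega> (\<lambda>x. c x - 2 * b x + a x))\<^sup>2)"
proof -
  let ?I = "\<lambda>f. LINT x:\<Omega>|lebesgue. f x"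
  let ?A = "\<lambda>x. 1/2 * ((c x)\<^sup>2 + (b x)\<^sup>2) * (1/2 * c x + 1/2 * b x) * (c x - b x)"
  let ?B = "\<lambda>x. (3/2 * b x - 1/2 * a x) * (c x - b x)"
  let ?C = "\<lambda>x. ((c x)\<^sup>2 - 1)\<^sup>2" and ?D = "\<lambda>x. ((b x)\<^sup>2 - 1)\<^sup>2"
  let ?E = "\<lambda>x. (c x - b x) * (c x - b x)" and ?F = "\<lambda>x. (b x - a x) * (b x - a x)"
  let ?H = "\<lambda>x. (c x - 2 * b x + a x) * (c x - 2 * b x + a x)"
  have int: "set_integrable lebesgue \<Omega> ?A" "set_integrable lebesgue \<Omega> ?B"
    "set_integrable lebesgue \<Omega> ?C" "set_integrable lebesgue \<Omega> ?D"
    "set_integrable lebesgue \<Omega> ?E" "set_integrable lebesgue \<Omega> ?F" "set_integrable lebesgue \<Omega> ?H"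
    by (intro bounded_cont_set_integrable[OF \<Omega>] bounded_cont_intros bc)+
  have "?I ?A - ?I ?B = ?I (\<lambda>x. ?A x - ?B x)"
    by (rule set_integral_diff(2)[symmetric, OF int(1,2)])
  also have "(\<lambda>x. ?A x - ?B x) = (\<lambda>x. 1/4 * (?C x - ?D x) + 1/4 * (?E x - ?F x + ?H x))"
    by (rule ext) algebra
  also have "?I \<dots> = ?I (\<lambda>x. 1/4 * (?C x - ?D x)) + ?I (\<lambda>x. 1/4 * (?E x - ?F x + ?H x))"
    by (intro set_integral_add set_integrable_mult_right set_integral_diff int)
  also have "?I (\<lambda>x. 1/4 * (?C x - ?D x)) = 1/4 * (?I ?C - ?I ?D)"
    unfolding set_integral_mult_right set_integral_diff(2)[OF int(3,4)] ..
  also have "?I (\<lambda>x. 1/4 * (?E x - ?F x + ?H x)) = 1/4 * (?I ?E - ?I ?F + ?I ?H)"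
    unfolding set_integral_mult_right
      set_integral_add(2)[OF set_integral_diff(1)[OF int(5,6)] int(7)] set_integral_diff(2)[OF int(5,6)] ..
  finally show ?thesis
    unfolding nrm_power2 ip_def inner_real_def .
qed

lemma kinetic_identity:
  fixes b c :: "'a::euclidean_space \<Rightarrow> 'b::euclidean_space"
  assumes "b \<in> L2 \<Omega>" "c \<in> L2 \<Omega>"
  shows "ip \<Omega> (\<lambda>x. c x - b x) (\<lambda>x. (1/2) *\<^sub>R c x + (1/2) *\<^sub>R b x)
    = 1/2 * ((nrm \<Omega> c)\<^sup>2 - (nrm \<Omega> b)\<^sup>2)"
proof -
  have eq: "(c x - b x) \<bullet> ((1/2) *\<^sub>R c x + (1/2) *\<^sub>R b x) = 1/2 * (c x \<bullet> c x - b x \<bullet> b x)" for x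
    by (simp add: inner_add_right inner_diff_left inner_commute[of "b x" "c x"] field_simps)
  show ?thesis
    unfolding nrm_power2 ip_def eq
      set_integral_diff(2)[OF L2_set_integrable_inner[OF assms(2) assms(2)]
        L2_set_integrable_inner[OF assms(1) assms(1)], symmetric]
    by simp
qed

lemma energy_split:
  assumes \<Omega>: "open \<Omega>" "bounded \<Omega>" and \<phi>: "bounded_cont \<Omega> \<phi>" "\<phi> \<in> H1 \<Omega>" and u: "u \<in> L2 \<Omega>"
  shows "energy \<Omega> \<epsilon> \<gamma> \<phi> u = 1 / (4 * \<epsilon>) * (LINT x:\<Omega>|lebesgue. ((\<phi> x)\<^sup>2 - 1)\<^sup>2)
    + \<epsilon> / 2 * (nrm \<Omega> (grad \<Omega> \<phi>))\<^sup>2 + 1 / (2 * \<gamma>) * (nrm \<Omega> u)\<^sup>2"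
proof -
  note g = grad_weak_grad(1)[OF \<phi>(2)]
  let ?Q = "\<lambda>x. 1 / (4 * \<epsilon>) * ((\<phi> x)\<^sup>2 - 1)\<^sup>2"
  let ?G = "\<lambda>x. \<epsilon> / 2 * (grad \<Omega> \<phi> x \<bullet> grad \<Omega> \<phi> x)"
  let ?U = "\<lambda>x. 1 / (2 * \<gamma>) * (u x \<bullet> u x)"
  have Q: "set_integrable lebesgue \<Omega> ?Q"
    by (intro bounded_cont_set_integrable[OF \<Omega>] bounded_cont_intros \<phi>)
  have G: "set_integrable lebesgue \<Omega> ?G"
    by (intro set_integrable_mult_right L2_set_integrable_inner g)
  have U: "set_integrable lebesgue \<Omega> ?U"
    by (intro set_integrable_mult_right L2_set_integrable_inner u)
  have "energy \<Omega> \<epsilon> \<gamma> \<phi> u = (LINT x:\<Omega>|lebesgue. ?Q x + ?G x + ?U x)"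
    by (simp add: energy_def power2_norm_eq_inner)
  also have "\<dots> = (LINT x:\<Omega>|lebesgue. ?Q x) + (LINT x:\<Omega>|lebesgue. ?G x) + (LINT x:\<Omega>|lebesgue. ?U x)"
    unfolding set_integral_add(2)[OF set_integral_add(1)[OF Q G] U] set_integral_add(2)[OF Q G] ..
  finally show ?thesis
    unfolding set_integral_mult_right nrm_power2 ip_def .
qed

text \<open>
  Testing with \<open>\<mu>h\<close>, \<open>\<delta>\<^sub>\<tau>\<phi>h\<close>, \<open>bar uh\<close> and \<open>bar ph\<close>, multiplying the momentum equation by
  \<open>1 / \<gamma>\<close>, and adding. The membership assumptions on the old iterates are what makes these
  test functions admissible.
\<close>

lemma scheme_step_energy:
  fixes \<Omega> :: "(real ^ 'd) set"
  assumes \<Omega>: "open \<Omega>" and mesh: "mesh_on \<Omega> Tr" and pos: "\<epsilon> > 0" "\<gamma> > 0" "\<tau> > 0"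
    and \<phi>: "\<phi>h (m - 1) \<in> Sh \<Omega> Tr q" "\<phi>h m \<in> Sh \<Omega> Tr q"
    and u: "uh m \<in> Xh \<Omega> Tr q" and p: "ph m \<in> Sh0 \<Omega> Tr q"
    and step: "scheme_step \<Omega> Tr q \<epsilon> \<eta> \<gamma> \<tau> \<phi>h \<mu>h uh ph m"
  shows "mod_energy \<Omega> \<epsilon> \<gamma> (\<phi>h (m + 1)) (\<phi>h m) (uh (m + 1))
    + \<tau> * (\<epsilon> * (nrm \<Omega> (grad \<Omega> (\<mu>h m)))\<^sup>2 + \<eta> / \<gamma> * (nrm \<Omega> (gradv \<Omega> (bar uh m)))\<^sup>2)
    + (1 / (4 * \<epsilon>) * (nrm \<Omega> (\<lambda>x. \<phi>h (m + 1) x - 2 * \<phi>h m x + \<phi>h (m - 1) x))\<^sup>2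
       + \<epsilon> / 8 * (nrm \<Omega> (\<lambda>x. grad \<Omega> (\<phi>h (m + 1)) x - 2 *\<^sub>R grad \<Omega> (\<phi>h m) x
                             + grad \<Omega> (\<phi>h (m - 1)) x))\<^sup>2)
    = mod_energy \<Omega> \<epsilon> \<gamma> (\<phi>h m) (\<phi>h (m - 1)) (uh m)"
proof -
  note bd = mesh_on_bounded[OF mesh]
  define a b c where "a = \<phi>h (m - 1)" and "b = \<phi>h m" and "c = \<phi>h (m + 1)"
  define u0 u1 where "u0 = uh m" and "u1 = uh (m + 1)"
  note defs = a_def b_def c_def u0_def u1_def
  have S: "a \<in> Mh \<Omega> Tr q" "b \<in> Mh \<Omega> Tr q" "c \<in> Mh \<Omega> Tr q"
    and \<mu>: "\<mu>h m \<in> Sh \<Omega> Tr q" and X: "u0 \<in> Xh \<Omega> Tr q" "u1 \<in> Xh \<Omega> Tr q" and P: "ph (m + 1) \<in> Sh0 \<Omega> Tr q"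
    using \<phi> u step by (auto simp: Sh_def defs scheme_step_def)
  have bc: "bounded_cont \<Omega> a" "bounded_cont \<Omega> b" "bounded_cont \<Omega> c"
    using Mh_bounded_cont[OF \<Omega> mesh] S by blast+
  have H: "a \<in> H1 \<Omega>" "b \<in> H1 \<Omega>" "c \<in> H1 \<Omega>"
    using Mh_in_H1(1)[OF \<Omega> mesh] S by blast+
  note g = grad_weak_grad(1)[OF H(1)] grad_weak_grad(1)[OF H(2)] grad_weak_grad(1)[OF H(3)]
  have uL2: "u0 \<in> L2 \<Omega>" "u1 \<in> L2 \<Omega>"
    using Xh_in_L2[OF \<Omega> mesh] X by blast+
  have dtau: "dtau \<tau> \<phi>h m = (\<lambda>x. 1/\<tau> * c x + (- (1/\<tau>)) * b x)"
    "dtau \<tau> \<phi>h m = (\<lambda>x. (1/\<tau>) *\<^sub>R (c x - b x))"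
    by (auto simp: dtau_def defs fun_eq_iff algebra_simps)
  have dS: "dtau \<tau> \<phi>h m \<in> Sh \<Omega> Tr q"
    unfolding dtau(1) Sh_def by (rule Mh_lincomb[OF S(3,2)])
  have barX: "bar uh m \<in> Xh \<Omega> Tr q"
    using bar_in_Xh[OF \<Omega> mesh] X by (simp add: defs)
  have barP: "bar ph m \<in> Sh0 \<Omega> Tr q"
    by (rule bar_in_Sh0[OF \<Omega> bd P p])
  let ?b = "b_form \<Omega> (tilde \<phi>h m) (bar uh m) (\<mu>h m)"
  let ?A = "(nrm \<Omega> (grad \<Omega> (\<mu>h m)))\<^sup>2" and ?V = "(nrm \<Omega> (gradv \<Omega> (bar uh m)))\<^sup>2"
  let ?d = "dtau \<tau> \<phi>h m"
  have S1: "ip \<Omega> ?d (\<mu>h m) + \<epsilon> * ?A + ?b = 0"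
    using step \<mu> by (auto simp: scheme_step_def a_form_def nrm_power2)
  have S2: "1 / \<epsilon> * ip \<Omega> (chi \<phi>h m) ?d - 1 / \<epsilon> * ip \<Omega> (tilde \<phi>h m) ?d
      + \<epsilon> * a_form \<Omega> (check \<phi>h m) ?d - ip \<Omega> ?d (\<mu>h m) = 0"
    using step dS by (auto simp: scheme_step_def ip_commute[of \<Omega> "\<mu>h m"])
  have S4: "c_form \<Omega> (bar uh m) (bar ph m) = 0"
    using step barP by (auto simp: scheme_step_def)
  have S3: "ip \<Omega> (dtau \<tau> uh m) (bar uh m) + \<eta> * ?V - \<gamma> * ?b = 0"
  proof -
    have "ip \<Omega> (dtau \<tau> uh m) (bar uh m) + \<eta> * av_form \<Omega> (bar uh m) (bar uh m)
        + B_form \<Omega> (tilde uh m) (bar uh m) (bar uh m) - c_form \<Omega> (bar uh m) (bar ph m) - \<gamma> * ?b = 0"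
      using step barX by (auto simp: scheme_step_def)
    moreover have "B_form \<Omega> (tilde uh m) (bar uh m) (bar uh m) = 0" by (simp add: B_form_def)
    ultimately show ?thesis using S4 by (simp add: av_form_def nrm_power2)
  qed
  let ?W = "1/4 * ((LINT x:\<Omega>|lebesgue. ((c x)\<^sup>2 - 1)\<^sup>2) - (LINT x:\<Omega>|lebesgue. ((b x)\<^sup>2 - 1)\<^sup>2))
      + 1/4 * ((nrm \<Omega> (\<lambda>x. c x - b x))\<^sup>2 - (nrm \<Omega> (\<lambda>x. b x - a x))\<^sup>2
        + (nrm \<Omega> (\<lambda>x. c x - 2 * b x + a x))\<^sup>2)"
  have W: "\<tau> * (ip \<Omega> (chi \<phi>h m) ?d - ip \<Omega> (tilde \<phi>h m) ?d) = ?W"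
  proof -
    have "chi \<phi>h m = (\<lambda>x. 1/2 * ((c x)\<^sup>2 + (b x)\<^sup>2) * (1/2 * c x + 1/2 * b x))"
      by (simp add: chi_def bar_def defs)
    moreover have "tilde \<phi>h m = (\<lambda>x. 3/2 * b x - 1/2 * a x)"
      by (simp add: tilde_def defs)
    ultimately show ?thesis
      unfolding double_well_identity[OF \<Omega> bd bc, symmetric] dtau(2) ip_scale_right
      using pos by (simp add: right_diff_distrib)
  qed
  let ?ga = "grad \<Omega> a" and ?gb = "grad \<Omega> b" and ?gc = "grad \<Omega> c"
  let ?G = "1/2 * ((nrm \<Omega> ?gc)\<^sup>2 - (nrm \<Omega> ?gb)\<^sup>2)
      + 1/8 * ((nrm \<Omega> (\<lambda>x. ?gc x - ?gb x))\<^sup>2 - (nrm \<Omega> (\<lambda>x. ?gb x - ?ga x))\<^sup>2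
        + (nrm \<Omega> (\<lambda>x. ?gc x - 2 *\<^sub>R ?gb x + ?ga x))\<^sup>2)"
  have G: "\<tau> * a_form \<Omega> (check \<phi>h m) ?d = ?G"
  proof -
    have ch: "check \<phi>h m = (\<lambda>x. 3/4 * c x + 1/4 * a x)"
      by (simp add: check_def defs)
    note gch = grad_lincomb[OF \<Omega> bd H(3,1), of "3/4" "1/4"]
    note gd = grad_lincomb[OF \<Omega> bd H(3,2), of "1/\<tau>" "- (1/\<tau>)"]
    have "a_form \<Omega> (check \<phi>h m) ?d = ip \<Omega> (\<lambda>x. (3/4) *\<^sub>R ?gc x + (1/4) *\<^sub>R ?ga x)
        (\<lambda>x. (1/\<tau>) *\<^sub>R ?gc x + (- (1/\<tau>)) *\<^sub>R ?gb x)"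
      unfolding a_form_def ch dtau(1)
      by (intro ip_cong_AE gch(2) gd(2) grad_weak_grad(1)[OF gch(1)] grad_weak_grad(1)[OF gd(1)] L2_lincomb g)
    also have "(\<lambda>x. (1/\<tau>) *\<^sub>R ?gc x + (- (1/\<tau>)) *\<^sub>R ?gb x) = (\<lambda>x. (1/\<tau>) *\<^sub>R (?gc x - ?gb x))"
      by (simp add: fun_eq_iff scaleR_diff_right)
    finally show ?thesis
      unfolding gradient_identity[OF g, symmetric] ip_scale_right using pos by simp
  qed
  have U: "\<tau> * ip \<Omega> (dtau \<tau> uh m) (bar uh m) = 1/2 * ((nrm \<Omega> u1)\<^sup>2 - (nrm \<Omega> u0)\<^sup>2)"
    unfolding kinetic_identity[OF uL2, symmetric] dtau_def bar_def ip_scale_left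
    using pos by (simp add: defs)
  have "\<tau> * (\<epsilon> * ?A + \<eta> / \<gamma> * ?V) + 1 / \<epsilon> * ?W + \<epsilon> * ?G
      + 1 / \<gamma> * (1/2 * ((nrm \<Omega> u1)\<^sup>2 - (nrm \<Omega> u0)\<^sup>2)) = 0"
  proof -
    have "\<epsilon> * ?A + \<eta> / \<gamma> * ?V + 1 / \<epsilon> * (ip \<Omega> (chi \<phi>h m) ?d - ip \<Omega> (tilde \<phi>h m) ?d)
        + \<epsilon> * a_form \<Omega> (check \<phi>h m) ?d + 1 / \<gamma> * ip \<Omega> (dtau \<tau> uh m) (bar uh m) = 0"
    proof -
      have "1 / \<gamma> * (ip \<Omega> (dtau \<tau> uh m) (bar uh m) + \<eta> * ?V - \<gamma> * ?b) = 0"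
        using S3 by simp
      then have "1 / \<gamma> * ip \<Omega> (dtau \<tau> uh m) (bar uh m) + \<eta> / \<gamma> * ?V - ?b = 0"
        using pos by (simp add: field_simps)
      with S1 S2 show ?thesis by (simp add: right_diff_distrib)
    qed
    then have "\<tau> * (\<epsilon> * ?A + \<eta> / \<gamma> * ?V) + 1 / \<epsilon> * (\<tau> * (ip \<Omega> (chi \<phi>h m) ?d - ip \<Omega> (tilde \<phi>h m) ?d))
        + \<epsilon> * (\<tau> * a_form \<Omega> (check \<phi>h m) ?d) + 1 / \<gamma> * (\<tau> * ip \<Omega> (dtau \<tau> uh m) (bar uh m)) = 0"
      using pos by (simp only: mult.left_commute[of _ \<tau>] distrib_left[symmetric])
    then show ?thesis unfolding W G U .
  qed
  moreover have "1 / (4 * \<epsilon>) = 1 / \<epsilon> * (1/4)" "\<epsilon> / 2 = \<epsilon> * (1/2)" "\<epsilon> / 8 = \<epsilon> * (1/8)" "1 / (2 * \<gamma>) = 1 / \<gamma> * (1/2)"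
    by simp_all
  ultimately show ?thesis
    unfolding mod_energy_def defs[symmetric] energy_split[OF \<Omega> bd bc(3) H(3) uL2(2)]
      energy_split[OF \<Omega> bd bc(2) H(2) uL2(1)]
    by (simp only: distrib_left right_diff_distrib mult.assoc)
qed

theorem lemma2p6:
  fixes \<Omega> :: "(real ^ 'd) set"
    and \<epsilon> \<eta> \<gamma> T \<tau> h :: real and M q :: nat
    and H :: "real set" and Tr :: "real \<Rightarrow> (real ^ 'd) set set"
    and \<phi>0 :: "real ^ 'd \<Rightarrow> real" and u0 :: "real ^ 'd \<Rightarrow> real ^ 'd"
    and \<phi> \<mu> p :: "real \<Rightarrow> real ^ 'd \<Rightarrow> real" and u :: "real \<Rightarrow> real ^ 'd \<Rightarrow> real ^ 'd"
    and \<phi>h \<mu>h ph :: "nat \<Rightarrow> real ^ 'd \<Rightarrow> real" and uh :: "nat \<Rightarrow> real ^ 'd \<Rightarrow> real ^ 'd"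
  assumes dim: "CARD('d) = 2 \<or> CARD('d) = 3"
    and domain: "polyhedral_domain \<Omega>"
    and params: "\<epsilon> > 0" "\<eta> > 0" "\<gamma> > 0" "T > 0" "M \<ge> 1" "q \<ge> 1"
    and step_size: "\<tau> = T / real M"
    and mesh: "mesh_family \<Omega> H Tr" "h \<in> H"
    and sol: "weak_solution \<Omega> T \<epsilon> \<eta> \<gamma> \<phi>0 u0 \<phi> \<mu> u p"
    and init_phi: "is_Ritz \<Omega> (Tr h) q \<phi>0 (\<phi>h 0)" "is_Ritz \<Omega> (Tr h) q (\<phi> \<tau>) (\<phi>h 1)"
    and init_u: "is_Stokes \<Omega> (Tr h) q \<eta> u0 (p 0) (uh 0) (ph 0)"
      "is_Stokes \<Omega> (Tr h) q \<eta> (u \<tau>) (p \<tau>) (uh 1) (ph 1)"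
    and scheme: "\<forall>m\<in>{1..M - 1}. scheme_step \<Omega> (Tr h) q \<epsilon> \<eta> \<gamma> \<tau> \<phi>h \<mu>h uh ph m"
  shows "\<forall>l\<in>{1..M - 1}.
    mod_energy \<Omega> \<epsilon> \<gamma> (\<phi>h (l + 1)) (\<phi>h l) (uh (l + 1))
    + \<tau> * (\<Sum>m=1..l. \<epsilon> * (nrm \<Omega> (grad \<Omega> (\<mu>h m)))\<^sup>2
                     + \<eta> / \<gamma> * (nrm \<Omega> (gradv \<Omega> (bar uh m)))\<^sup>2)
    + (\<Sum>m=1..l.
         1 / (4 * \<epsilon>) * (nrm \<Omega> (\<lambda>x. \<phi>h (m + 1) x - 2 * \<phi>h m x + \<phi>h (m - 1) x))\<^sup>2
         + \<epsilon> / 8 * (nrm \<Omega> (\<lambda>x. grad \<Omega> (\<phi>h (m + 1)) x - 2 *\<^sub>R grad \<Omega> (\<phi>h m) x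
                                 + grad \<Omega> (\<phi>h (m - 1)) x))\<^sup>2)
    = mod_energy \<Omega> \<epsilon> \<gamma> (\<phi>h 1) (\<phi>h 0) (uh 1)"
proof -
  have \<Omega>: "open \<Omega>" using domain by (auto simp: polyhedral_domain_def)
  have mesh_h: "mesh_on \<Omega> (Tr h)" using mesh by (auto simp: mesh_family_def)
  have \<tau>: "\<tau> > 0" using params step_size by simp
  have in_spaces: "\<phi>h k \<in> Sh \<Omega> (Tr h) q \<and> uh k \<in> Xh \<Omega> (Tr h) q \<and> ph k \<in> Sh0 \<Omega> (Tr h) q"
    if "k \<le> M" for k
  proof -
    consider "k = 0" | "k = 1" | n where "k = n + 1" "1 \<le> n" by (cases k) fastforce+
    then show ?thesis
    proof cases
      case 3
      then have "scheme_step \<Omega> (Tr h) q \<epsilon> \<eta> \<gamma> \<tau> \<phi>h \<mu>h uh ph n" using that scheme by auto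
      with 3 show ?thesis by (simp add: scheme_step_def)
    qed (use init_phi init_u in \<open>auto simp: is_Ritz_def is_Stokes_def Vh_def\<close>)
  qed
  define F where "F k = mod_energy \<Omega> \<epsilon> \<gamma> (\<phi>h (k + 1)) (\<phi>h k) (uh (k + 1))" for k
  define D where "D m = \<epsilon> * (nrm \<Omega> (grad \<Omega> (\<mu>h m)))\<^sup>2
      + \<eta> / \<gamma> * (nrm \<Omega> (gradv \<Omega> (bar uh m)))\<^sup>2" for m
  define N where "N m = 1 / (4 * \<epsilon>) * (nrm \<Omega> (\<lambda>x. \<phi>h (m + 1) x - 2 * \<phi>h m x + \<phi>h (m - 1) x))\<^sup>2
      + \<epsilon> / 8 * (nrm \<Omega> (\<lambda>x. grad \<Omega> (\<phi>h (m + 1)) x - 2 *\<^sub>R grad \<Omega> (\<phi>h m) x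
                             + grad \<Omega> (\<phi>h (m - 1)) x))\<^sup>2" for m
  have step: "F m + \<tau> * D m + N m = F (m - 1)" if "m \<in> {1..M - 1}" for m
  proof -
    have "m \<le> M" "m - 1 \<le> M" "m - 1 + 1 = m" using that by auto
    then show ?thesis
      unfolding F_def D_def N_def
      using scheme_step_energy[OF \<Omega> mesh_h params(1,3) \<tau>, of \<phi>h m q uh ph \<eta> \<mu>h] in_spaces scheme that
      by simp
  qed
  have "F l + \<tau> * (\<Sum>m=1..l. D m) + (\<Sum>m=1..l. N m) = F 0" if "l \<le> M - 1" for l
    using that
  proof (induction l)
    case (Suc l)
    then show ?case
      using step[of "Suc l"] by (simp add: distrib_left)
  qed simp
  then show ?thesis by (auto simp: F_def D_def N_def)
qed

end
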